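(* The randomly shifted standard lattice $\mu_{\mathbb{Z}^5}$ in $\mathbb{R}^5$ satisfies $$\liminf_{R\to+\infty}\frac{\mathrm{NV}_{\mu_{\mathbb{Z}^5}}(R)}{\mathrm{Vol}_4(\partial B_R)}=0 .$$
   Context: $\mu_{\mathbb{Z}^5}$ is the law of the random point measure $\sum_{\gamma\in\mathbb{Z}^5}\delta_{\gamma+U}$ with $U$ uniformly distributed on $\mathbb{R}^5/\mathbb{Z}^5$ (equivalently on $[0,1)^5$). $B_R$ is the Euclidean ball of radius $R$ centered at the origin of $\mathbb{R}^5$, $\mathrm{Vol}_4(\partial B_R)$ is its surface measure, and $\mathrm{NV}_{\mu_{\mathbb{Z}^5}}(R)=\mathrm{Var}\big(|(\mathbb{Z}^5+U)\cap B_R|\big)$. *)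

theory Defs
  imports "HOL-Probability.Probability"
begin

definition locally_finite_measures :: "'a::topological_space measure set" where
  "locally_finite_measures =
    {M. sets M = sets borel \<and> (\<forall>K. compact K \<longrightarrow> emeasure M K < \<infinity>)}"

text \<open>
  The \<open>\<sigma>\<close>-algebra generated by the evaluations \<open>M \<mapsto> M A\<close>, as in \<open>subprob_algebra\<close>,
  which does not apply here because the measures are infinite.
\<close>
definition random_measure_algebra :: "'a::topological_space measure measure" where
  "random_measure_algebra =
    (SUP A \<in> sets borel. vimage_algebra locally_finite_measures (\<lambda>M. emeasure M A) borel)"

definition number_variance :: "'a::real_normed_vector measure measure \<Rightarrow> real \<Rightarrow> real" where
  "number_variance \<mu> R = prob_space.variance \<mu> (\<lambda>M. measure M (cball 0 R))"

definition integer_lattice :: "(real ^ 'n) set" where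
  "integer_lattice = {x. \<forall>i. x $ i \<in> \<int>}"

definition uniform_unit_cube :: "(real ^ 'n) measure" where
  "uniform_unit_cube = uniform_measure lborel {x. \<forall>i. 0 \<le> x $ i \<and> x $ i < 1}"

text \<open>
  The push-forward of counting measure along \<open>\<gamma> \<mapsto> \<gamma> + u\<close> is the sum of the Dirac
  masses at the points \<open>\<gamma> + u\<close>, with \<open>\<gamma>\<close> ranging over the lattice.
\<close>
definition shifted_lattice_measure :: "real ^ 'n \<Rightarrow> (real ^ 'n) measure" where
  "shifted_lattice_measure u = distr (count_space integer_lattice) borel (\<lambda>\<gamma>. \<gamma> + u)"

definition shifted_lattice_law :: "(real ^ 'n) measure measure" where
  "shifted_lattice_law =
    distr uniform_unit_cube random_measure_algebra shifted_lattice_measure"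

text \<open>
  The covers are restricted to bounded sets because \<open>diameter\<close> is unspecified otherwise. Empty
  sets are treated separately so that they contribute nothing for \<open>k = 0\<close> either.
\<close>
definition hausdorff_premeasure :: "nat \<Rightarrow> real \<Rightarrow> 'a::metric_space set \<Rightarrow> ennreal" where
  "hausdorff_premeasure k \<delta> A =
    (INF U \<in> {U :: nat \<Rightarrow> 'a set. A \<subseteq> (\<Union>i. U i) \<and> (\<forall>i. bounded (U i) \<and> diameter (U i) \<le> \<delta>)}.
      \<Sum>i. if U i = {} then 0 else ennreal (unit_ball_vol (real k) * (diameter (U i) / 2) ^ k))"

text \<open>
  The factor \<open>unit_ball_vol\<close> normalises the measure so that it agrees with
  \<open>k\<close>-dimensional Euclidean volume on \<open>k\<close>-dimensional surfaces.
\<close>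
definition hausdorff_measure :: "nat \<Rightarrow> 'a::metric_space set \<Rightarrow> ennreal" where
  "hausdorff_measure k A = (SUP \<delta> \<in> {0<..}. hausdorff_premeasure k \<delta> A)"

lemma countable_integer_lattice: "countable (integer_lattice :: (real ^ 'n) set)"
proof -
  have "integer_lattice \<subseteq> range (\<lambda>f :: int ^ 'n. (\<chi> i. real_of_int (f $ i)) :: real ^ 'n)"
  proof
    fix x :: "real ^ 'n" assume "x \<in> integer_lattice"
    then have "\<forall>i. x $ i \<in> \<int>" by (simp add: integer_lattice_def)
    then have "x = (\<chi> i. real_of_int ((\<chi> i. \<lfloor>x $ i\<rfloor>) $ i))"
      by (simp add: vec_eq_iff)
    then show "x \<in> range (\<lambda>f :: int ^ 'n. (\<chi> i. real_of_int (f $ i)) :: real ^ 'n)" by blast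
  qed
  moreover have "countable (UNIV :: (int ^ 'n) set)"
  proof -
    have "inj (vec_nth :: int ^ 'n \<Rightarrow> _)" by (simp add: inj_def vec_nth_inject)
    moreover have "countable (UNIV :: ('n \<Rightarrow> int) set)" by simp
    ultimately show ?thesis by (metis countable_image_inj_on countable_subset subset_UNIV)
  qed
  ultimately show ?thesis by (meson countable_image countable_subset)
qed

lemma emeasure_shifted_lattice_measure:
  assumes "A \<in> sets borel"
  shows "emeasure (shifted_lattice_measure u) A =
    (\<integral>\<^sup>+ \<gamma>. indicator A (\<gamma> + u) \<partial>count_space integer_lattice)"
proof -
  have "(\<integral>\<^sup>+ x. indicator A x \<partial>shifted_lattice_measure u) =
      (\<integral>\<^sup>+ \<gamma>. indicator A (\<gamma> + u) \<partial>count_space integer_lattice)"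
    unfolding shifted_lattice_measure_def using assms by (intro nn_integral_distr) auto
  then show ?thesis
    using assms by (simp add: shifted_lattice_measure_def)
qed

lemma finite_integer_lattice_bounded:
  assumes "bounded (B :: (real ^ 'n) set)"
  shows "finite (integer_lattice \<inter> B)"
proof -
  obtain b where b: "\<And>x. x \<in> B \<Longrightarrow> norm x \<le> b" using assms bounded_iff by metis
  have "{v :: real ^ 'n. \<forall>i. v $ i \<in> S} \<subseteq> vec_lambda ` (UNIV \<rightarrow>\<^sub>E S)" for S :: "real set"
    by (auto simp: image_iff PiE_iff intro!: bexI[of _ "vec_nth _"])
  then have fin: "finite {v :: real ^ 'n. \<forall>i. v $ i \<in> of_int ` {\<lfloor>-b\<rfloor>..\<lceil>b\<rceil>}}"
    by (rule finite_subset) (auto intro!: finite_PiE)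
  have "integer_lattice \<inter> B \<subseteq> {v. \<forall>i. v $ i \<in> of_int ` {\<lfloor>-b\<rfloor>..\<lceil>b\<rceil>}}"
  proof safe
    fix x :: "real ^ 'n" and i assume x: "x \<in> integer_lattice" "x \<in> B"
    obtain m :: int where m: "x $ i = of_int m"
      using x(1) by (auto simp: integer_lattice_def elim!: Ints_cases)
    have "\<bar>x $ i\<bar> \<le> b" using b[OF x(2)] component_le_norm_cart[of x i] by linarith
    then have "m \<in> {\<lfloor>-b\<rfloor>..\<lceil>b\<rceil>}" using m by (simp; linarith)
    then show "x $ i \<in> of_int ` {\<lfloor>-b\<rfloor>..\<lceil>b\<rceil>}" using m by blast
  qed
  then show ?thesis using fin finite_subset by blast
qed

lemma shifted_lattice_measure_locally_finite:
  "shifted_lattice_measure u \<in> locally_finite_measures"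
proof -
  have "emeasure (shifted_lattice_measure u) K < \<infinity>" if "compact K" for K
  proof -
    have "emeasure (shifted_lattice_measure u) K =
        emeasure (count_space integer_lattice) {\<gamma> \<in> integer_lattice. \<gamma> + u \<in> K}"
      using that by (simp add: shifted_lattice_measure_def emeasure_distr borel_compact
          vimage_def Int_def conj_commute)
    also have "{\<gamma> \<in> integer_lattice. \<gamma> + u \<in> K} = integer_lattice \<inter> (\<lambda>x. x - u) ` K"
      by (force simp: image_iff)
    also have "emeasure (count_space integer_lattice) \<dots> < \<infinity>"
      using finite_integer_lattice_bounded[OF compact_imp_bounded[OF compact_translation_subtract[OF that]]]
      by (subst emeasure_count_space_finite) (auto simp: of_nat_less_top)
    finally show ?thesis .
  qed
  then show ?thesis by (simp add: locally_finite_measures_def shifted_lattice_measure_def)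
qed

lemma measurable_shifted_lattice_measure:
  "shifted_lattice_measure \<in> measurable uniform_unit_cube random_measure_algebra"
  unfolding random_measure_algebra_def
proof (rule measurable_SUP2)
  fix A :: "(real ^ 'n) set" assume A: "A \<in> sets borel"
  have "(\<lambda>u. emeasure (shifted_lattice_measure u) A) \<in> borel_measurable borel"
  proof -
    have "sigma_finite_measure (count_space (integer_lattice :: (real ^ 'n) set))"
      by (intro sigma_finite_measure_count_space_countable countable_integer_lattice)
    moreover have "(\<lambda>p. indicator A (snd p + fst p) :: ennreal)
        \<in> borel_measurable (borel \<Otimes>\<^sub>M count_space integer_lattice)"
    proof (rule measurable_compose_countable'[where g = snd and I = integer_lattice])
      show "(\<lambda>p. indicator A (\<gamma> + fst p) :: ennreal)
          \<in> borel_measurable (borel \<Otimes>\<^sub>M count_space integer_lattice)" for \<gamma>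
        using A by measurable
    qed (auto simp: countable_integer_lattice)
    then have "(\<lambda>(u, \<gamma>). indicator A (\<gamma> + u) :: ennreal)
        \<in> borel_measurable (borel \<Otimes>\<^sub>M count_space integer_lattice)"
      by (simp add: case_prod_unfold)
    ultimately show ?thesis
      using A by (simp add: emeasure_shifted_lattice_measure sigma_finite_measure.borel_measurable_nn_integral)
  qed
  then show "shifted_lattice_measure
      \<in> measurable uniform_unit_cube (vimage_algebra locally_finite_measures (\<lambda>M. emeasure M A) borel)"
    by (intro measurable_vimage_algebra2)
      (auto simp: shifted_lattice_measure_locally_finite uniform_unit_cube_def)
qed auto

end

theory Submission
  imports Defs
begin

text \<open>
  By Parseval's identity on the torus, the number variance of the shifted lattice in the ball of
  radius \<open>R\<close> is the sum of \<open>|F R k|\<^sup>2\<close> over the nonzero lattice vectors \<open>k\<close>, where \<open>F R\<close> is the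
  Fourier transform of the indicator function of the ball. In dimension five, \<open>F R k\<close> is an elementary function:
  slicing the ball orthogonally to \<open>k\<close> gives the integral of \<open>(R\<^sup>2 - t\<^sup>2)\<^sup>2\<close> against an exponential,
  and up to a term of relative order \<open>1 / R\<close> its value is a constant times
  \<open>R\<^sup>2 sin (2 \<pi> |k| R) / |k| ^ 3\<close> (lemma \<open>norm_cball_transform_le\<close>).

  The variance divided by \<open>R ^ 4\<close> is therefore controlled by the sum of
  \<open>sin\<^sup>2 (2 \<pi> |k| R) / |k| ^ 6\<close>. As \<open>6 > 5\<close>, the sum of \<open>1 / |k| ^ 6\<close> converges
  (lemma \<open>sum_integer_lattice_bounded\<close>), so finitely many frequencies carry almost all
  of it. For these, Dirichlet's theorem on simultaneous approximation produces arbitrarily large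
  \<open>R\<close> for which every \<open>|k| R\<close> is close to an integer (lemma \<open>simultaneously_small_sines\<close>), which makes all
  the relevant sines small at once. Along such \<open>R\<close> the variance is of smaller order than \<open>R ^ 4\<close>
  (lemma \<open>number_variance_small\<close>). The surface measure of the sphere is \<open>R ^ 4\<close> times that of the unit
  sphere by homogeneity of Hausdorff measure (lemma \<open>hausdorff_measure_sphere\<close>), and the claim follows.

  The upper bound in Parseval's identity rests on the lattice point count being a limit
  in mean square of trigonometric polynomials (lemma \<open>cball_count_L2_approx\<close>), which comes from the
  Stone--Weierstrass theorem on the torus.
\<close>

section \<open>Homogeneity of Hausdorff measure\<close>

lemma diameter_scaleR_le:
  fixes S :: "'a::real_normed_vector set"
  assumes "bounded S" "0 < r"
  shows "diameter ((*\<^sub>R) r ` S) \<le> r * diameter S"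
proof (rule diameter_le)
  show "(*\<^sub>R) r ` S \<noteq> {} \<or> 0 \<le> r * diameter S"
    using assms by (simp add: diameter_ge_0)
  fix x y assume "x \<in> (*\<^sub>R) r ` S" "y \<in> (*\<^sub>R) r ` S"
  then obtain a b where ab: "a \<in> S" "b \<in> S" "x = r *\<^sub>R a" "y = r *\<^sub>R b" by blast
  have "norm (x - y) = r * dist a b"
    using ab assms by (simp add: dist_norm flip: scaleR_diff_right)
  also have "\<dots> \<le> r * diameter S"
    using diameter_bounded_bound[OF assms(1) ab(1,2)] assms by simp
  finally show "norm (x - y) \<le> r * diameter S" .
qed

text \<open>
  Scaling the sets of a cover of \<open>A\<close> by \<open>r\<close> gives a cover of the scaled set with diameters at most \<open>r\<close>
  times as large and a weight that is at most \<open>r ^ k\<close> times as large. The infimum over all covers is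
  pulled past the factor \<open>r ^ k\<close> by multiplying with the inverse factor first.
\<close>

lemma hausdorff_premeasure_scaleR_le:
  fixes A :: "'a::real_normed_vector set"
  assumes r: "0 < r"
  shows "hausdorff_premeasure k (r * \<delta>) ((*\<^sub>R) r ` A) \<le> ennreal (r ^ k) * hausdorff_premeasure k \<delta> A"
proof -
  let ?c = "ennreal (r ^ k)"
  let ?d = "\<lambda>U. \<Sum>i. if U i = {} then 0
    else ennreal (unit_ball_vol (real k) * (diameter (U i) / 2) ^ k)"
  have *: "hausdorff_premeasure k (r * \<delta>) ((*\<^sub>R) r ` A) \<le> ?c * ?d U"
    if U: "A \<subseteq> (\<Union>i. U i)" "\<And>i. bounded (U i) \<and> diameter (U i) \<le> \<delta>" for U :: "nat \<Rightarrow> 'a set"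
  proof -
    have 1: "diameter ((*\<^sub>R) r ` U i) \<le> r * diameter (U i)" for i
      using diameter_scaleR_le U(2) r by blast
    have "hausdorff_premeasure k (r * \<delta>) ((*\<^sub>R) r ` A) \<le> ?d (\<lambda>i. (*\<^sub>R) r ` U i)"
      unfolding hausdorff_premeasure_def
    proof (rule INF_lower, safe)
      fix i show "bounded ((*\<^sub>R) r ` U i)" using U(2) by (simp add: bounded_scaling)
      show "diameter ((*\<^sub>R) r ` U i) \<le> r * \<delta>"
        using 1[of i] U(2)[of i] r by (meson mult_le_cancel_left_pos order_trans)
    next
      fix x assume "x \<in> A"
      then show "r *\<^sub>R x \<in> (\<Union>i. (*\<^sub>R) r ` U i)" using U(1) by blast
    qed
    also have "\<dots> \<le> (\<Sum>i. ?c * (if U i = {} then 0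
        else ennreal (unit_ball_vol (real k) * (diameter (U i) / 2) ^ k)))"
    proof (rule suminf_le)
      fix i
      have "(diameter ((*\<^sub>R) r ` U i) / 2) ^ k \<le> (r * diameter (U i) / 2) ^ k"
        using 1[of i] U(2)[of i]
        by (intro power_mono divide_right_mono divide_nonneg_nonneg diameter_ge_0)
          (auto simp: bounded_scaling)
      then have "unit_ball_vol (real k) * (diameter ((*\<^sub>R) r ` U i) / 2) ^ k
          \<le> unit_ball_vol (real k) * (r * diameter (U i) / 2) ^ k"
        by (rule mult_left_mono) simp
      also have "\<dots> = r ^ k * (unit_ball_vol (real k) * (diameter (U i) / 2) ^ k)"
        by (simp add: power_mult_distrib power_divide)
      finally have "unit_ball_vol (real k) * (diameter ((*\<^sub>R) r ` U i) / 2) ^ k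
          \<le> r ^ k * (unit_ball_vol (real k) * (diameter (U i) / 2) ^ k)" .
      then show "(if (*\<^sub>R) r ` U i = {} then 0
          else ennreal (unit_ball_vol (real k) * (diameter ((*\<^sub>R) r ` U i) / 2) ^ k))
        \<le> ?c * (if U i = {} then 0
          else ennreal (unit_ball_vol (real k) * (diameter (U i) / 2) ^ k))"
        using r by (auto simp: ennreal_mult'[symmetric] intro!: ennreal_leI)
    qed auto
    also have "\<dots> = ?c * ?d U" by (rule ennreal_suminf_cmult)
    finally show ?thesis .
  qed
  let ?c' = "ennreal ((1 / r) ^ k)"
  have cc: "?c' * ?c = 1" "?c * ?c' = 1"
    using r by (simp_all add: ennreal_mult[symmetric] power_mult_distrib[symmetric])
  have "?c' * hausdorff_premeasure k (r * \<delta>) ((*\<^sub>R) r ` A) \<le> hausdorff_premeasure k \<delta> A"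
    unfolding hausdorff_premeasure_def[of k \<delta> A]
  proof (rule INF_greatest)
    fix U :: "nat \<Rightarrow> 'a set"
    assume U: "U \<in> {U. A \<subseteq> (\<Union>i. U i) \<and> (\<forall>i. bounded (U i) \<and> diameter (U i) \<le> \<delta>)}"
    have "?c' * hausdorff_premeasure k (r * \<delta>) ((*\<^sub>R) r ` A) \<le> ?c' * (?c * ?d U)"
      by (rule mult_left_mono) (use * U in auto)
    also have "\<dots> = ?d U" by (simp only: mult.assoc[symmetric] cc mult_1)
    finally show "?c' * hausdorff_premeasure k (r * \<delta>) ((*\<^sub>R) r ` A) \<le> ?d U" .
  qed
  then have "?c * (?c' * hausdorff_premeasure k (r * \<delta>) ((*\<^sub>R) r ` A))
      \<le> ?c * hausdorff_premeasure k \<delta> A"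
    by (rule mult_left_mono) simp
  then show ?thesis by (simp only: mult.assoc[symmetric] cc mult_1)
qed

lemma hausdorff_measure_scaleR_le:
  fixes A :: "'a::real_normed_vector set"
  assumes r: "0 < r"
  shows "hausdorff_measure k ((*\<^sub>R) r ` A) \<le> ennreal (r ^ k) * hausdorff_measure k A"
  unfolding hausdorff_measure_def[of k "(*\<^sub>R) r ` A"]
proof (rule SUP_least)
  fix \<delta> :: real assume \<delta>: "\<delta> \<in> {0<..}"
  have "hausdorff_premeasure k (r * (\<delta> / r)) ((*\<^sub>R) r ` A)
      \<le> ennreal (r ^ k) * hausdorff_premeasure k (\<delta> / r) A"
    by (rule hausdorff_premeasure_scaleR_le[OF r])
  also have "\<dots> \<le> ennreal (r ^ k) * hausdorff_measure k A"
    unfolding hausdorff_measure_def using \<delta> r by (intro mult_left_mono SUP_upper) auto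
  finally show "hausdorff_premeasure k \<delta> ((*\<^sub>R) r ` A) \<le> ennreal (r ^ k) * hausdorff_measure k A"
    using r by simp
qed

text \<open>
  The reverse inequality is the first one, applied to the scaled set and the factor \<open>1 / r\<close>.
\<close>

lemma hausdorff_measure_scaleR:
  fixes A :: "'a::real_normed_vector set"
  assumes r: "0 < r"
  shows "hausdorff_measure k ((*\<^sub>R) r ` A) = ennreal (r ^ k) * hausdorff_measure k A"
proof (rule antisym)
  have "hausdorff_measure k A = hausdorff_measure k ((*\<^sub>R) (1 / r) ` (*\<^sub>R) r ` A)"
    using r by (simp add: image_image)
  also have "\<dots> \<le> ennreal ((1 / r) ^ k) * hausdorff_measure k ((*\<^sub>R) r ` A)"
    using r by (intro hausdorff_measure_scaleR_le) simp
  finally have "ennreal (r ^ k) * hausdorff_measure k A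
      \<le> ennreal (r ^ k) * (ennreal ((1 / r) ^ k) * hausdorff_measure k ((*\<^sub>R) r ` A))"
    by (rule mult_left_mono) simp
  also have "\<dots> = hausdorff_measure k ((*\<^sub>R) r ` A)"
    using r by (simp add: mult.assoc[symmetric] ennreal_mult[symmetric] power_mult_distrib[symmetric])
  finally show "ennreal (r ^ k) * hausdorff_measure k A \<le> hausdorff_measure k ((*\<^sub>R) r ` A)" .
qed (rule hausdorff_measure_scaleR_le[OF r])

lemma hausdorff_measure_sphere:
  assumes "0 < R"
  shows "enn2real (hausdorff_measure k (frontier (cball 0 R) :: 'a::euclidean_space set))
    = R ^ k * enn2real (hausdorff_measure k (sphere 0 1 :: 'a set))"
proof -
  have "x \<in> (*\<^sub>R) R ` sphere 0 1" if "norm x = R" for x :: 'a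
    using that assms by (intro image_eqI[of _ _ "x /\<^sub>R R"]) auto
  then have "(frontier (cball 0 R) :: 'a set) = (*\<^sub>R) R ` sphere 0 1"
    using assms by (auto simp: frontier_cball)
  then show ?thesis
    using assms by (simp add: hausdorff_measure_scaleR enn2real_mult)
qed

section \<open>The unit cube and periodization over the integer lattice\<close>

definition unit_cube :: "(real ^ 'n) set" where
  "unit_cube = {x. \<forall>i. 0 \<le> x $ i \<and> x $ i < 1}"

lemma unit_cube_borel [measurable]: "unit_cube \<in> sets borel"
  unfolding unit_cube_def by measurable

lemma emeasure_unit_cube: "emeasure lborel (unit_cube :: (real ^ 'n) set) = 1"
proof -
  have one: "(\<chi> i. 1) \<bullet> b = 1" if "b \<in> Basis" for b :: "real ^ 'n"
    using that by (auto simp: Basis_vec_def inner_axis)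
  have "box 0 (\<chi> i. 1) \<subseteq> (unit_cube :: (real ^ 'n) set)"
    "(unit_cube :: (real ^ 'n) set) \<subseteq> cbox 0 (\<chi> i. 1)"
    by (auto simp: unit_cube_def mem_box_cart less_imp_le)
  then have "emeasure lborel (box 0 (\<chi> i. 1) :: (real ^ 'n) set) \<le> emeasure lborel (unit_cube :: (real ^ 'n) set)"
    "emeasure lborel (unit_cube :: (real ^ 'n) set) \<le> emeasure lborel (cbox 0 (\<chi> i. 1) :: (real ^ 'n) set)"
    by (auto intro!: emeasure_mono)
  moreover have "emeasure lborel (box 0 (\<chi> i. 1) :: (real ^ 'n) set) = 1"
    "emeasure lborel (cbox 0 (\<chi> i. 1) :: (real ^ 'n) set) = 1"
    by (simp_all add: emeasure_lborel_box_eq emeasure_lborel_cbox_eq one)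
  ultimately show ?thesis by simp
qed

lemma prob_space_uniform_unit_cube: "prob_space (uniform_unit_cube :: (real ^ 'n) measure)"
  unfolding uniform_unit_cube_def unit_cube_def[symmetric]
  by (rule prob_space_uniform_measure) (simp_all add: emeasure_unit_cube)

lemma sets_uniform_unit_cube [measurable_cong]: "sets uniform_unit_cube = sets borel"
  by (simp add: uniform_unit_cube_def)

lemma space_uniform_unit_cube [simp]: "space uniform_unit_cube = UNIV"
  by (simp add: uniform_unit_cube_def)

lemma integral_uniform_unit_cube:
  fixes f :: "real ^ 'n \<Rightarrow> 'b::{banach, second_countable_topology}"
  assumes [measurable]: "f \<in> borel_measurable borel"
  shows "(\<integral>u. f u \<partial>uniform_unit_cube) = (\<integral>u. indicator unit_cube u *\<^sub>R f u \<partial>lborel)"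
proof -
  have "(uniform_unit_cube :: (real ^ 'n) measure) = density lborel (\<lambda>x. ennreal (indicator unit_cube x :: real) :: ennreal)"
    unfolding uniform_unit_cube_def uniform_measure_def unit_cube_def[symmetric]
    by (simp add: emeasure_unit_cube ennreal_indicator divide_ennreal_def)
  moreover have "(\<integral>u. f u \<partial>density lborel (\<lambda>x. ennreal (indicator unit_cube x)))
      = (\<integral>u. indicator unit_cube u *\<^sub>R f u \<partial>lborel)"
    by (rule integral_density) simp_all
  ultimately show ?thesis by simp
qed

lemma AE_uniform_unit_cube: "AE u in uniform_unit_cube. u \<in> unit_cube"
  unfolding uniform_unit_cube_def unit_cube_def[symmetric]
  by (rule AE_uniform_measureI) auto

lemma norm_unit_cube_le: "u \<in> unit_cube \<Longrightarrow> norm (u :: real ^ 'n) \<le> real CARD('n)"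
proof -
  assume u: "u \<in> unit_cube"
  have "norm u \<le> (\<Sum>i\<in>UNIV. \<bar>u $ i\<bar>)" by (rule norm_le_l1_cart)
  also have "\<dots> \<le> (\<Sum>i\<in>(UNIV::'n set). 1)"
    using u by (intro sum_mono) (auto simp: unit_cube_def less_imp_le)
  finally show ?thesis by simp
qed

text \<open>
  The lattice point of the translate of the unit cube that contains the given point.
\<close>

definition floor_vec :: "real ^ 'n \<Rightarrow> real ^ 'n" where
  "floor_vec x = (\<chi> i. of_int \<lfloor>x $ i\<rfloor>)"

lemma floor_vec_lattice: "floor_vec x \<in> integer_lattice"
  by (simp add: floor_vec_def integer_lattice_def)

lemma diff_mem_unit_cube_iff:
  assumes "\<gamma> \<in> integer_lattice"
  shows "x - \<gamma> \<in> unit_cube \<longleftrightarrow> \<gamma> = floor_vec x"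
proof
  assume *: "x - \<gamma> \<in> unit_cube"
  have "\<gamma> $ i = of_int \<lfloor>x $ i\<rfloor>" for i
  proof -
    obtain m :: int where m: "\<gamma> $ i = of_int m"
      using assms by (auto simp: integer_lattice_def elim!: Ints_cases)
    have "\<lfloor>x $ i\<rfloor> = m"
      using * m by (auto simp: unit_cube_def floor_eq_iff algebra_simps dest!: spec[of _ i])
    then show ?thesis using m by simp
  qed
  then show "\<gamma> = floor_vec x" by (simp add: floor_vec_def vec_eq_iff)
next
  assume "\<gamma> = floor_vec x"
  then show "x - \<gamma> \<in> unit_cube"
    by (auto simp: floor_vec_def unit_cube_def; linarith)
qed

lemma integer_lattice_add: "a \<in> integer_lattice \<Longrightarrow> b \<in> integer_lattice \<Longrightarrow> a + b \<in> integer_lattice"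
  and integer_lattice_diff: "a \<in> integer_lattice \<Longrightarrow> b \<in> integer_lattice \<Longrightarrow> a - b \<in> integer_lattice"
  and integer_lattice_minus: "a \<in> integer_lattice \<Longrightarrow> - a \<in> integer_lattice"
  and integer_lattice_0: "0 \<in> integer_lattice"
  by (auto simp: integer_lattice_def)

text \<open>
  For compactly supported \<open>h\<close>, the sum over the lattice is locally finite. The number of points of
  the shifted lattice in a ball is the periodization of the indicator function of that ball, which
  is how lattice point counts enter Fourier analysis.
\<close>

definition periodization :: "(real ^ 'n \<Rightarrow> 'b) \<Rightarrow> real ^ 'n \<Rightarrow> 'b::{banach, second_countable_topology}" where
  "periodization h u = (\<Sum>\<^sub>\<infinity>\<gamma>\<in>integer_lattice. h (\<gamma> + u))"

lemma periodization_shift: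
  assumes "v \<in> integer_lattice"
  shows "periodization h (u + v) = periodization h u"
  unfolding periodization_def
  by (rule infsum_reindex_bij_witness[where j = "\<lambda>\<gamma>. \<gamma> + v" and i = "\<lambda>\<gamma>. \<gamma> - v"])
    (use assms in \<open>auto simp: algebra_simps intro: integer_lattice_add integer_lattice_diff\<close>)

lemma periodization_eq_sum:
  fixes u :: "real ^ 'n"
  assumes h: "\<And>x. r < norm x \<Longrightarrow> h x = 0" and u: "norm u \<le> D"
  shows "periodization h u = (\<Sum>\<gamma>\<in>integer_lattice \<inter> cball 0 (r + D). h (\<gamma> + u))"
proof -
  have "periodization h u = (\<Sum>\<^sub>\<infinity>\<gamma>\<in>integer_lattice \<inter> cball 0 (r + D). h (\<gamma> + u))"
    unfolding periodization_def
  proof (rule infsum_cong_neutral)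
    fix \<gamma> :: "real ^ 'n"
    assume "\<gamma> \<in> integer_lattice - integer_lattice \<inter> cball 0 (r + D)"
    then have "r + D < norm \<gamma>" by auto
    also have "norm \<gamma> \<le> norm (\<gamma> + u) + norm u"
      using norm_triangle_ineq4[of "\<gamma> + u" u] by simp
    finally show "h (\<gamma> + u) = 0" using h u by auto
  qed auto
  then show ?thesis by (simp add: finite_integer_lattice_bounded)
qed

text \<open>
  By periodicity, the value at \<open>u\<close> is the value at the representative of \<open>u\<close> in the unit cube, where
  one finite sum represents the periodization.
\<close>

lemma borel_measurable_periodization:
  fixes h :: "real ^ 'n \<Rightarrow> 'b::{banach, second_countable_topology}"
  assumes "h \<in> borel_measurable borel" and h: "\<And>x. r < norm x \<Longrightarrow> h x = 0"
  shows "periodization h \<in> borel_measurable borel"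
proof -
  have "periodization h = (\<lambda>u. periodization h (u - floor_vec u))"
  proof
    fix u :: "real ^ 'n"
    show "periodization h u = periodization h (u - floor_vec u)"
      using periodization_shift[of "- floor_vec u" h u] by (simp add: floor_vec_lattice integer_lattice_minus)
  qed
  also have "\<dots> = (\<lambda>u. \<Sum>\<gamma>\<in>integer_lattice \<inter> cball 0 (r + real CARD('n)). h (\<gamma> + (u - floor_vec u)))"
    by (intro ext periodization_eq_sum h norm_unit_cube_le)
      (simp_all add: diff_mem_unit_cube_iff floor_vec_lattice)
  also have "\<dots> \<in> borel_measurable borel"
  proof -
    have [measurable]: "floor_vec \<in> borel_measurable (borel :: (real ^ 'n) measure)"
      unfolding floor_vec_def by (subst borel_measurable_euclidean_space)
        (auto simp: Basis_vec_def inner_axis)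
    show ?thesis using assms(1) by measurable
  qed
  finally show ?thesis .
qed

text \<open>
  The lattice translates of the unit cube tile space, so that integrating a periodization over one
  cube amounts to integrating the original function over all of space.
\<close>

lemma integral_periodization:
  fixes h :: "real ^ 'n \<Rightarrow> 'b::{banach, second_countable_topology}"
  assumes h: "integrable lborel h" "\<And>x. r < norm x \<Longrightarrow> h x = 0"
  shows "(\<integral>u. periodization h u \<partial>uniform_unit_cube) = (\<integral>x. h x \<partial>lborel)"
proof -
  define \<Gamma> :: "(real ^ 'n) set" where "\<Gamma> = integer_lattice \<inter> cball 0 (r + real CARD('n))"
  have fin: "finite \<Gamma>" by (simp add: \<Gamma>_def finite_integer_lattice_bounded)
  have [measurable]: "h \<in> borel_measurable borel" using h(1) by auto
  have "(\<integral>u. periodization h u \<partial>uniform_unit_cube)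
      = (\<integral>u. indicator unit_cube u *\<^sub>R periodization h u \<partial>lborel)"
    by (rule integral_uniform_unit_cube) (rule borel_measurable_periodization[OF _ h(2)], simp_all)
  also have "\<dots> = (\<integral>u. (\<Sum>\<gamma>\<in>\<Gamma>. indicator unit_cube u *\<^sub>R h (\<gamma> + u)) \<partial>lborel)"
  proof (intro Bochner_Integration.integral_cong refl)
    fix u :: "real ^ 'n"
    show "indicator unit_cube u *\<^sub>R periodization h u = (\<Sum>\<gamma>\<in>\<Gamma>. indicator unit_cube u *\<^sub>R h (\<gamma> + u))"
      using periodization_eq_sum[OF h(2) norm_unit_cube_le, where u = u]
      by (cases "u \<in> unit_cube") (simp_all add: \<Gamma>_def)
  qed
  also have "\<dots> = (\<Sum>\<gamma>\<in>\<Gamma>. \<integral>u. indicator unit_cube u *\<^sub>R h (\<gamma> + u) \<partial>lborel)"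
  proof (rule Bochner_Integration.integral_sum)
    fix \<gamma> :: "real ^ 'n"
    have "integrable (distr lborel borel ((+) \<gamma>)) h" using h(1) by (simp add: lborel_distr_plus)
    then have "integrable lborel (\<lambda>u. h (\<gamma> + u))" by (simp add: integrable_distr_eq)
    then show "integrable lborel (\<lambda>u. indicator unit_cube u *\<^sub>R h (\<gamma> + u))"
      by (intro integrable_mult_indicator) auto
  qed
  also have "\<dots> = (\<Sum>\<gamma>\<in>\<Gamma>. \<integral>x. indicator unit_cube (x - \<gamma>) *\<^sub>R h x \<partial>lborel)"
  proof (intro sum.cong refl)
    fix \<gamma> :: "real ^ 'n"
    have "(\<integral>x. indicator unit_cube (x - \<gamma>) *\<^sub>R h x \<partial>lborel)
        = (\<integral>x. indicator unit_cube (x - \<gamma>) *\<^sub>R h x \<partial>distr lborel borel ((+) \<gamma>))"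
      by (simp add: lborel_distr_plus)
    also have "\<dots> = (\<integral>u. indicator unit_cube u *\<^sub>R h (\<gamma> + u) \<partial>lborel)"
      by (subst integral_distr) simp_all
    finally show "(\<integral>u. indicator unit_cube u *\<^sub>R h (\<gamma> + u) \<partial>lborel)
        = (\<integral>x. indicator unit_cube (x - \<gamma>) *\<^sub>R h x \<partial>lborel)" by simp
  qed
  also have "\<dots> = (\<integral>x. (\<Sum>\<gamma>\<in>\<Gamma>. indicator unit_cube (x - \<gamma>) *\<^sub>R h x) \<partial>lborel)"
  proof (rule Bochner_Integration.integral_sum[symmetric])
    fix \<gamma> :: "real ^ 'n"
    have "integrable lborel (\<lambda>x. indicator {x. x - \<gamma> \<in> unit_cube} x *\<^sub>R h x)"
      using h(1) by (intro integrable_mult_indicator) simp_all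
    then show "integrable lborel (\<lambda>x. indicator unit_cube (x - \<gamma>) *\<^sub>R h x)"
      by (simp add: indicator_def)
  qed
  also have "\<dots> = (\<integral>x. h x \<partial>lborel)"
  proof (intro Bochner_Integration.integral_cong refl)
    fix x :: "real ^ 'n"
    show "(\<Sum>\<gamma>\<in>\<Gamma>. indicator unit_cube (x - \<gamma>) *\<^sub>R h x) = h x"
    proof (cases "r < norm x")
      case False
      have "norm (floor_vec x) \<le> norm x + norm (x - floor_vec x)"
        using norm_triangle_ineq4[of x "x - floor_vec x"] by simp
      also have "\<dots> \<le> r + real CARD('n)"
        using False norm_unit_cube_le[of "x - floor_vec x"]
        by (simp add: diff_mem_unit_cube_iff floor_vec_lattice)
      finally have "floor_vec x \<in> \<Gamma>" by (simp add: \<Gamma>_def floor_vec_lattice)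
      moreover have "(\<Sum>\<gamma>\<in>\<Gamma>. indicator unit_cube (x - \<gamma>) *\<^sub>R h x)
          = (\<Sum>\<gamma>\<in>\<Gamma>. if \<gamma> = floor_vec x then h x else 0)"
        by (intro sum.cong refl) (auto simp: indicator_def diff_mem_unit_cube_iff \<Gamma>_def)
      ultimately show ?thesis using fin by simp
    qed (simp add: h(2))
  qed
  finally show ?thesis .
qed

section \<open>Characters and mean square approximation\<close>

definition character :: "real ^ 'n \<Rightarrow> real ^ 'n \<Rightarrow> complex" where
  "character k u = cis (2 * pi * (k \<bullet> u))"

lemma character_0 [simp]: "character 0 = (\<lambda>u. 1)"
  by (simp add: character_def fun_eq_iff)

lemma character_add_left: "character (k + l) u = character k u * character l u"
  by (simp add: character_def cis_mult inner_add_left algebra_simps)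

lemma character_add_right: "character k (u + v) = character k u * character k v"
  by (simp add: character_def cis_mult inner_add_right algebra_simps)

lemma cnj_character: "cnj (character k u) = character (- k) u"
  by (simp add: character_def cis_cnj)

lemma norm_character [simp]: "norm (character k u) = 1"
  by (simp add: character_def)

lemma continuous_on_character: "continuous_on S (character k)"
  unfolding character_def by (intro continuous_intros)

lemma borel_measurable_character [measurable]: "character k \<in> borel_measurable borel"
  by (intro borel_measurable_continuous_onI continuous_on_character)

lemma inner_integer_lattice:
  assumes "k \<in> integer_lattice" "v \<in> integer_lattice"
  shows "k \<bullet> v \<in> \<int>"
  using assms by (auto simp: inner_vec_def integer_lattice_def intro!: Ints_sum Ints_mult)

lemma character_shift:
  assumes "k \<in> integer_lattice" "v \<in> integer_lattice"
  shows "character k (v + u) = character k u"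
  using inner_integer_lattice[OF assms]
  by (simp add: character_add_right) (simp add: character_def)

lemma integrable_uniform_unit_cube_bounded:
  fixes f :: "real ^ 'n \<Rightarrow> 'b::{banach, second_countable_topology}"
  assumes "f \<in> borel_measurable borel" "\<And>u. u \<in> unit_cube \<Longrightarrow> norm (f u) \<le> b"
  shows "integrable uniform_unit_cube f"
proof -
  interpret prob_space "uniform_unit_cube :: (real ^ 'n) measure" by (rule prob_space_uniform_unit_cube)
  show ?thesis
  proof (rule integrable_const_bound)
    show "AE u in uniform_unit_cube. norm (f u) \<le> b"
      using AE_uniform_unit_cube by eventually_elim (rule assms(2))
  qed (use assms(1) in measurable)
qed

text \<open>
  The integral of a periodic function over the cube does not change when the function is translated.
  Translating by a vector \<open>v\<close> with \<open>k \<bullet> v = 1/2\<close> multiplies the character by \<open>-1\<close>, so that the integral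
  is its own negative. Translation invariance comes from the tiling: \<open>h\<close> below is the character cut
  off to the translated cube, and its periodization is the full character again.
\<close>

lemma integral_character:
  fixes k :: "real ^ 'n"
  assumes k: "k \<in> integer_lattice" "k \<noteq> 0"
  shows "(\<integral>u. character k u \<partial>uniform_unit_cube) = 0"
proof -
  let ?I = "\<integral>u. character k u \<partial>uniform_unit_cube"
  obtain i where i: "k $ i \<noteq> 0" using k(2) by (auto simp: vec_eq_iff)
  define v :: "real ^ 'n" where "v = axis i (1 / (2 * k $ i))"
  have v: "character k v = -1"
    using i by (simp add: character_def v_def inner_axis)
  define h where "h x = indicator unit_cube (x - v) *\<^sub>R character k x" for x
  have [measurable]: "h \<in> borel_measurable borel" unfolding h_def by measurable
  have "periodization h = character k"
  proof
    fix u
    have "periodization h u = (\<Sum>\<^sub>\<infinity>\<gamma>\<in>{- floor_vec (u - v)}. character k u)"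
      unfolding periodization_def
    proof (rule infsum_cong_neutral)
      fix \<gamma> assume *: "\<gamma> \<in> integer_lattice - {- floor_vec (u - v)}"
      then have "(u - v) - (- \<gamma>) \<notin> unit_cube"
        by (subst diff_mem_unit_cube_iff) (auto simp: integer_lattice_minus minus_equation_iff[of \<gamma>])
      then show "h (\<gamma> + u) = 0" by (simp add: h_def algebra_simps)
    next
      fix \<gamma> assume "\<gamma> \<in> integer_lattice \<inter> {- floor_vec (u - v)}"
      then have \<gamma>: "\<gamma> \<in> integer_lattice" "- \<gamma> = floor_vec (u - v)" by auto
      then have "(u - v) - (- \<gamma>) \<in> unit_cube"
        by (subst diff_mem_unit_cube_iff) (auto simp: integer_lattice_minus floor_vec_lattice)
      then show "h (\<gamma> + u) = character k u"
        using \<gamma>(1) by (simp add: h_def algebra_simps) (simp add: character_shift[OF k(1)] add.commute)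
    qed (auto simp: floor_vec_lattice integer_lattice_minus)
    then show "periodization h u = character k u" by simp
  qed
  moreover have "(\<integral>u. periodization h u \<partial>uniform_unit_cube) = (\<integral>x. h x \<partial>lborel)"
  proof (rule integral_periodization)
    have "integrable lborel (\<lambda>x. indicator (cball 0 (norm v + real CARD('n))) x *\<^sub>R h x)"
      by (rule integrableI_bounded_set_indicator[of _ _ _ 1])
        (auto simp: h_def emeasure_bounded_finite[simplified] split: split_indicator)
    also have "(\<lambda>x. indicator (cball 0 (norm v + real CARD('n))) x *\<^sub>R h x) = h"
    proof
      fix x
      have "norm x \<le> norm v + real CARD('n)" if "x - v \<in> unit_cube"
        using norm_unit_cube_le[OF that] norm_triangle_ineq[of v "x - v"] by simp
      then show "indicator (cball 0 (norm v + real CARD('n))) x *\<^sub>R h x = h x"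
        by (auto simp: h_def indicator_def)
    qed
    finally show "integrable lborel h" .
    show "h x = 0" if "norm v + real CARD('n) < norm x" for x
    proof -
      have "x - v \<notin> unit_cube"
        using that norm_unit_cube_le[of "x - v"] norm_triangle_ineq[of v "x - v"] by auto
      then show ?thesis by (simp add: h_def)
    qed
  qed
  moreover have "(\<integral>x. h x \<partial>lborel) = (\<integral>x. h x \<partial>distr lborel borel ((+) v))"
    by (simp add: lborel_distr_plus)
  moreover have "\<dots> = (\<integral>u. indicator unit_cube u *\<^sub>R character k (v + u) \<partial>lborel)"
    by (subst integral_distr) (simp_all add: h_def)
  moreover have "\<dots> = (\<integral>u. character k v * character k u \<partial>uniform_unit_cube)"
    by (subst integral_uniform_unit_cube) (simp_all add: character_add_right)
  ultimately have "?I = - ?I" by (simp add: v)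
  then show ?thesis by simp
qed

lemma integral_character_mult_cnj:
  fixes k l :: "real ^ 'n"
  assumes "k \<in> integer_lattice" "l \<in> integer_lattice"
  shows "(\<integral>u. character k u * cnj (character l u) \<partial>uniform_unit_cube) = (if k = l then 1 else 0)"
proof -
  interpret prob_space "uniform_unit_cube :: (real ^ 'n) measure" by (rule prob_space_uniform_unit_cube)
  have "(\<lambda>u. character k u * cnj (character l u)) = character (k - l)"
    by (auto simp: cnj_character simp flip: character_add_left)
  then show ?thesis
    using integral_character[of "k - l"] assms prob_space
    by (simp add: integer_lattice_diff)
qed

definition fourier_coeff :: "(real ^ 'n \<Rightarrow> complex) \<Rightarrow> real ^ 'n \<Rightarrow> complex" where
  "fourier_coeff f k = (\<integral>u. f u * cnj (character k u) \<partial>uniform_unit_cube)"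

text \<open>
  Among the trigonometric polynomials with frequencies in \<open>S\<close>, the partial sum of the Fourier series
  is the best approximation of \<open>f\<close> in mean square. The squared distance of \<open>f\<close> from that sum is
  \<open>\<parallel>f\<parallel>\<^sup>2 - \<Sum>k\<in>S. |f\<^sub>k|\<^sup>2\<close>, where \<open>f\<^sub>k\<close> are the Fourier coefficients of \<open>f\<close>, and
  it is at most the squared distance from any competitor \<open>p\<close>. This is the half of
  Parseval's identity that bounds a norm by Fourier coefficients, with the approximation error
  kept explicit.
\<close>

lemma L2_norm_le_fourier_coeff:
  fixes f :: "real ^ 'n \<Rightarrow> complex"
  assumes f [measurable]: "f \<in> borel_measurable borel" and b: "\<And>u. u \<in> unit_cube \<Longrightarrow> norm (f u) \<le> b"
    and S: "finite S" "S \<subseteq> integer_lattice"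
    and p: "p = (\<lambda>u. \<Sum>k\<in>S. c k * character k u)"
  shows "(\<integral>u. (norm (f u))\<^sup>2 \<partial>uniform_unit_cube)
    \<le> (\<Sum>k\<in>S. (norm (fourier_coeff f k))\<^sup>2) + (\<integral>u. (norm (f u - p u))\<^sup>2 \<partial>uniform_unit_cube)"
proof -
  let ?M = "uniform_unit_cube :: (real ^ 'n) measure"
  let ?F = "fourier_coeff f"
  have [measurable]: "cnj \<in> borel_measurable borel"
    by (intro borel_measurable_continuous_onI continuous_intros)
  have pm [measurable]: "p \<in> borel_measurable borel" unfolding p by measurable
  have pb: "norm (p u) \<le> (\<Sum>k\<in>S. norm (c k))" for u
    unfolding p by (rule sum_norm_le) (simp add: norm_mult)
  have int: "integrable ?M (\<lambda>u. g u * cnj (h u))"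
    if [measurable]: "g \<in> borel_measurable borel" "h \<in> borel_measurable borel"
      and "\<And>u. u \<in> unit_cube \<Longrightarrow> norm (g u) \<le> x" "\<And>u. u \<in> unit_cube \<Longrightarrow> norm (h u) \<le> y"
    for g h x y
  proof (rule integrable_uniform_unit_cube_bounded)
    show "norm (g u * cnj (h u)) \<le> x * y" if "u \<in> unit_cube" for u
      using that \<open>\<And>u. u \<in> unit_cube \<Longrightarrow> norm (g u) \<le> x\<close> \<open>\<And>u. u \<in> unit_cube \<Longrightarrow> norm (h u) \<le> y\<close>
      unfolding norm_mult complex_mod_cnj by (intro mult_mono) (auto intro: order_trans[OF norm_ge_zero])
  qed simp
  have fp: "(\<integral>u. f u * cnj (p u) \<partial>?M) = (\<Sum>k\<in>S. cnj (c k) * ?F k)"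
  proof -
    have "(\<integral>u. f u * cnj (p u) \<partial>?M) = (\<integral>u. (\<Sum>k\<in>S. cnj (c k) * (f u * cnj (character k u))) \<partial>?M)"
      by (simp add: p sum_distrib_left mult_ac)
    also have "\<dots> = (\<Sum>k\<in>S. \<integral>u. cnj (c k) * (f u * cnj (character k u)) \<partial>?M)"
      by (intro Bochner_Integration.integral_sum integrable_mult_right int[where x = b and y = 1] b) auto
    finally show ?thesis by (simp add: fourier_coeff_def)
  qed
  have pf: "(\<integral>u. p u * cnj (f u) \<partial>?M) = (\<Sum>k\<in>S. c k * cnj (?F k))"
  proof -
    have "(\<integral>u. p u * cnj (f u) \<partial>?M) = cnj (\<integral>u. f u * cnj (p u) \<partial>?M)"
      using Bochner_Integration.integral_cnj[of ?M "\<lambda>u. f u * cnj (p u)"] by (simp add: mult.commute)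
    then show ?thesis by (simp add: fp)
  qed
  have pe: "fourier_coeff p k = c k" if k: "k \<in> S" for k
  proof -
    have "fourier_coeff p k = (\<integral>u. (\<Sum>l\<in>S. c l * (character l u * cnj (character k u))) \<partial>?M)"
      by (simp add: fourier_coeff_def p sum_distrib_right mult.assoc)
    also have "\<dots> = (\<Sum>l\<in>S. \<integral>u. c l * (character l u * cnj (character k u)) \<partial>?M)"
      by (intro Bochner_Integration.integral_sum integrable_mult_right int[where x = 1 and y = 1]) auto
    also have "\<dots> = (\<Sum>l\<in>S. if l = k then c k else 0)"
      by (intro sum.cong refl) (use S k in \<open>auto simp: integral_character_mult_cnj subset_iff\<close>)
    finally show ?thesis using S k by simp
  qed
  have pp: "(\<integral>u. p u * cnj (p u) \<partial>?M) = (\<Sum>k\<in>S. cnj (c k) * c k)"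
  proof -
    have "(\<integral>u. p u * cnj (p u) \<partial>?M) = (\<integral>u. (\<Sum>k\<in>S. cnj (c k) * (p u * cnj (character k u))) \<partial>?M)"
      by (subst (2) p) (simp add: sum_distrib_left mult_ac)
    also have "\<dots> = (\<Sum>k\<in>S. \<integral>u. cnj (c k) * (p u * cnj (character k u)) \<partial>?M)"
      by (intro Bochner_Integration.integral_sum integrable_mult_right int[where x = "\<Sum>k\<in>S. norm (c k)" and y = 1] pb) auto
    also have "\<dots> = (\<Sum>k\<in>S. cnj (c k) * fourier_coeff p k)"
      by (simp add: fourier_coeff_def)
    finally show ?thesis using pe by simp
  qed
  have sq: "complex_of_real (\<integral>u. (norm (g u))\<^sup>2 \<partial>?M) = (\<integral>u. g u * cnj (g u) \<partial>?M)" for g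
    by (simp add: complex_norm_square flip: integral_complex_of_real of_real_power)
  have "complex_of_real (\<integral>u. (norm (f u - p u))\<^sup>2 \<partial>?M)
      = (\<integral>u. (f u * cnj (f u) - f u * cnj (p u)) - (p u * cnj (f u) - p u * cnj (p u)) \<partial>?M)"
    by (simp add: sq algebra_simps)
  also have "\<dots> = (\<integral>u. f u * cnj (f u) \<partial>?M) - (\<integral>u. f u * cnj (p u) \<partial>?M)
      - ((\<integral>u. p u * cnj (f u) \<partial>?M) - (\<integral>u. p u * cnj (p u) \<partial>?M))"
  proof -
    note i = int[OF f f b b] int[OF f pm b pb] int[OF pm f pb b] int[OF pm pm pb pb]
    show ?thesis by (simp add: i)
  qed
  also have "\<dots> = complex_of_real (\<integral>u. (norm (f u))\<^sup>2 \<partial>?M)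
      - (\<Sum>k\<in>S. ?F k * cnj (?F k)) + (\<Sum>k\<in>S. (?F k - c k) * cnj (?F k - c k))"
    unfolding fp pf pp sq by (simp add: algebra_simps sum.distrib sum_subtractf)
  also have "\<dots> = complex_of_real ((\<integral>u. (norm (f u))\<^sup>2 \<partial>?M)
      - (\<Sum>k\<in>S. (norm (?F k))\<^sup>2) + (\<Sum>k\<in>S. (norm (?F k - c k))\<^sup>2))"
    by (simp only: of_real_add of_real_diff of_real_sum complex_norm_square)
  finally have "(\<integral>u. (norm (f u - p u))\<^sup>2 \<partial>?M) = (\<integral>u. (norm (f u))\<^sup>2 \<partial>?M)
      - (\<Sum>k\<in>S. (norm (?F k))\<^sup>2) + (\<Sum>k\<in>S. (norm (?F k - c k))\<^sup>2)"
    by (simp only: of_real_eq_iff)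
  moreover have "0 \<le> (\<Sum>k\<in>S. (norm (?F k - c k))\<^sup>2)" by (simp add: sum_nonneg)
  ultimately show ?thesis by simp
qed

section \<open>Density of trigonometric polynomials\<close>

definition trig_polynomial :: "(real ^ 'n \<Rightarrow> complex) \<Rightarrow> bool" where
  "trig_polynomial p \<longleftrightarrow>
    (\<exists>S c. finite S \<and> S \<subseteq> integer_lattice \<and> p = (\<lambda>u. \<Sum>k\<in>S. c k * character k u))"

lemma trig_polynomial_monomial:
  assumes "k \<in> integer_lattice"
  shows "trig_polynomial (\<lambda>u. c * character k u)"
  unfolding trig_polynomial_def
  by (rule exI[of _ "{k}"], rule exI[of _ "\<lambda>_. c"]) (use assms in simp)

lemma trig_polynomial_const: "trig_polynomial (\<lambda>u. c)"
  using trig_polynomial_monomial[OF integer_lattice_0, of c] by simp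

lemma trig_polynomial_add:
  assumes "trig_polynomial p" "trig_polynomial q"
  shows "trig_polynomial (\<lambda>u. p u + q u)"
proof -
  obtain S c where S: "finite S" "S \<subseteq> integer_lattice" "p = (\<lambda>u. \<Sum>k\<in>S. c k * character k u)"
    using assms(1) by (auto simp: trig_polynomial_def)
  obtain T d where T: "finite T" "T \<subseteq> integer_lattice" "q = (\<lambda>u. \<Sum>k\<in>T. d k * character k u)"
    using assms(2) by (auto simp: trig_polynomial_def)
  define e where "e k = (if k \<in> S then c k else 0) + (if k \<in> T then d k else 0)" for k
  have "p u + q u = (\<Sum>k\<in>S \<union> T. e k * character k u)" for u
  proof -
    have "p u = (\<Sum>k\<in>S \<union> T. (if k \<in> S then c k else 0) * character k u)"
      unfolding S(3) using S T by (intro sum.mono_neutral_cong_left) auto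
    moreover have "q u = (\<Sum>k\<in>S \<union> T. (if k \<in> T then d k else 0) * character k u)"
      unfolding T(3) using S T by (intro sum.mono_neutral_cong_left) auto
    ultimately show ?thesis by (simp add: e_def distrib_right sum.distrib)
  qed
  then show ?thesis
    unfolding trig_polynomial_def using S T
    by (intro exI[of _ "S \<union> T"] exI[of _ e]) auto
qed

lemma trig_polynomial_sum:
  assumes "\<And>i. i \<in> I \<Longrightarrow> trig_polynomial (p i)"
  shows "trig_polynomial (\<lambda>u. \<Sum>i\<in>I. p i u)"
  using assms by (induction I rule: infinite_finite_induct)
    (auto intro: trig_polynomial_const trig_polynomial_add)

lemma trig_polynomial_mult:
  assumes "trig_polynomial p" "trig_polynomial q"
  shows "trig_polynomial (\<lambda>u. p u * q u)"
proof -
  obtain S c where S: "S \<subseteq> integer_lattice" "p = (\<lambda>u. \<Sum>k\<in>S. c k * character k u)"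
    using assms(1) by (auto simp: trig_polynomial_def)
  obtain T d where T: "T \<subseteq> integer_lattice" "q = (\<lambda>u. \<Sum>k\<in>T. d k * character k u)"
    using assms(2) by (auto simp: trig_polynomial_def)
  have eq: "(\<lambda>u. p u * q u) = (\<lambda>u. \<Sum>k\<in>S. \<Sum>l\<in>T. (c k * d l) * character (k + l) u)"
    by (simp add: S T sum_product character_add_left mult_ac)
  show ?thesis
    unfolding eq using S T by (intro trig_polynomial_sum trig_polynomial_monomial integer_lattice_add) auto
qed

text \<open>
  The quotient map from space onto the torus, realised as a product of unit circles.
\<close>

definition torus_map :: "real ^ 'n \<Rightarrow> complex ^ 'n" where
  "torus_map u = (\<chi> i. character (axis i 1) u)"

lemma axis_integer_lattice: "axis i 1 \<in> integer_lattice"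
  by (simp add: integer_lattice_def axis_def)

lemma continuous_on_torus_map: "continuous_on S torus_map"
  unfolding torus_map_def by (intro continuous_on_vec_lambda continuous_on_character)

lemma torus_map_eq_imp:
  assumes "torus_map u = torus_map v"
  shows "u - v \<in> integer_lattice"
proof -
  have "u $ i - v $ i \<in> \<int>" for i
  proof -
    have "cis (2 * pi * u $ i) = cis (2 * pi * v $ i)"
      using assms by (simp add: torus_map_def vec_eq_iff character_def inner_axis')
    then have "cos (2 * pi * u $ i - 2 * pi * v $ i) = 1"
      by (simp add: cos_diff cis.ctr complex_eq_iff)
    then obtain n :: int where "2 * pi * u $ i - 2 * pi * v $ i = of_int n * 2 * pi"
      using cos_one_2pi_int by blast
    then have "2 * pi * (u $ i - v $ i) = 2 * pi * of_int n" by (simp add: algebra_simps)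
    then have "u $ i - v $ i = of_int n" by simp
    then show ?thesis by simp
  qed
  then show ?thesis by (simp add: integer_lattice_def)
qed

lemma trig_polynomial_Re_Im:
  shows "trig_polynomial (\<lambda>u. complex_of_real (Re (torus_map u $ i)))"
    and "trig_polynomial (\<lambda>u. complex_of_real (Im (torus_map u $ i)))"
proof -
  have "complex_of_real (Re z) = 1/2 * z + 1/2 * cnj z" for z
    by (simp add: complex_eq_iff)
  moreover have "complex_of_real (Im z) = (-\<i>/2) * z + (\<i>/2) * cnj z" for z
    by (simp add: complex_eq_iff)
  ultimately show "trig_polynomial (\<lambda>u. complex_of_real (Re (torus_map u $ i)))"
    "trig_polynomial (\<lambda>u. complex_of_real (Im (torus_map u $ i)))"
    by (simp_all only: torus_map_def vec_lambda_beta cnj_character)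
      (intro trig_polynomial_add trig_polynomial_monomial integer_lattice_minus axis_integer_lattice)+
qed

text \<open>
  A continuous periodic function factors through the compact torus, and the factor is continuous
  because a continuous map from a compact set is closed. The functions on the torus that pull back
  to trigonometric polynomials form an algebra that separates points, so the Stone--Weierstrass
  theorem applies to the factor.
\<close>

lemma trig_polynomial_dense:
  fixes \<phi> :: "real ^ 'n \<Rightarrow> real"
  assumes cont: "continuous_on (cbox 0 (\<chi> i. 1)) \<phi>"
    and per: "\<And>u v. v \<in> integer_lattice \<Longrightarrow> \<phi> (u + v) = \<phi> u"
    and e: "0 < e"
  shows "\<exists>g. trig_polynomial (\<lambda>u. complex_of_real (g u)) \<and> (\<forall>u\<in>unit_cube. \<bar>\<phi> u - g u\<bar> < e)"
proof -
  define K :: "(real ^ 'n) set" where "K = cbox 0 (\<chi> i. 1)"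
  define T where "T = torus_map ` K"
  have T: "compact T"
    unfolding T_def K_def by (intro compact_continuous_image continuous_on_torus_map compact_cbox)
  define F where "F z = \<phi> (SOME u. u \<in> K \<and> torus_map u = z)" for z
  have F: "F (torus_map u) = \<phi> u" if "u \<in> K" for u
  proof -
    let ?v = "SOME v. v \<in> K \<and> torus_map v = torus_map u"
    have "?v \<in> K \<and> torus_map ?v = torus_map u" by (rule someI[of _ u]) (use that in simp)
    then have "u - ?v \<in> integer_lattice" by (intro torus_map_eq_imp) simp
    from per[OF this, of ?v] show ?thesis by (simp add: F_def)
  qed
  have "continuous_on T F"
    unfolding continuous_on_closed_vimage[OF compact_imp_closed[OF T]]
  proof safe
    fix C :: "real set" assume "closed C"
    have "closed (\<phi> -` C \<inter> K)"
      using continuous_on_closed_vimage[of K \<phi>] cont \<open>closed C\<close> by (simp add: K_def closed_cbox)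
    then have "compact (\<phi> -` C \<inter> K)"
      using compact_Int_closed[of K "\<phi> -` C \<inter> K"] by (simp add: K_def Int_ac)
    then have "compact (torus_map ` (\<phi> -` C \<inter> K))"
      by (intro compact_continuous_image continuous_on_torus_map)
    also have "torus_map ` (\<phi> -` C \<inter> K) = F -` C \<inter> T"
      by (auto simp: T_def F)
    finally show "closed (F -` C \<inter> T)" by (rule compact_imp_closed)
  qed
  have "\<exists>g. (continuous_on T g \<and> trig_polynomial (\<lambda>u :: real ^ 'n. complex_of_real (g (torus_map u))))
    \<and> (\<forall>z\<in>T. \<bar>F z - g z\<bar> < e)"
  proof (rule Stone_Weierstrass_HOL[OF T])
    fix x y assume "x \<in> T \<and> y \<in> T \<and> x \<noteq> y"
    then obtain i where "Re (x $ i) \<noteq> Re (y $ i) \<or> Im (x $ i) \<noteq> Im (y $ i)"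
      by (auto simp: vec_eq_iff complex_eq_iff)
    moreover have "continuous_on T (\<lambda>z. Re (z $ i))" "continuous_on T (\<lambda>z. Im (z $ i))"
      by (intro continuous_intros)+
    ultimately show "\<exists>f. (continuous_on T f \<and> trig_polynomial (\<lambda>u :: real ^ 'n. complex_of_real (f (torus_map u)))) \<and> f x \<noteq> f y"
      using trig_polynomial_Re_Im[of i] by blast
  qed (use \<open>continuous_on T F\<close> e in \<open>auto intro: trig_polynomial_const trig_polynomial_add
      trig_polynomial_mult continuous_intros\<close>)
  then obtain g where g: "trig_polynomial (\<lambda>u :: real ^ 'n. complex_of_real (g (torus_map u)))"
    "\<And>z. z \<in> T \<Longrightarrow> \<bar>F z - g z\<bar> < e" by blast
  moreover have "u \<in> K" if "u \<in> unit_cube" for u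
    using that by (auto simp: unit_cube_def K_def mem_box_cart less_imp_le)
  ultimately show ?thesis
    by (intro exI[of _ "\<lambda>u. g (torus_map u)"]) (auto simp: F[symmetric] T_def)
qed

lemma continuous_on_periodization:
  fixes h :: "real ^ 'n \<Rightarrow> 'b::{banach, second_countable_topology}"
  assumes "continuous_on UNIV h" "\<And>x. r < norm x \<Longrightarrow> h x = 0" "bounded K"
  shows "continuous_on K (periodization h)"
proof -
  obtain D where D: "\<And>u. u \<in> K \<Longrightarrow> norm u \<le> D" using assms(3) bounded_iff by metis
  have "continuous_on K (\<lambda>u. \<Sum>\<gamma>\<in>integer_lattice \<inter> cball 0 (r + D). h (\<gamma> + u))"
    by (intro continuous_intros continuous_on_compose2[OF assms(1)]) auto
  then show ?thesis
    by (rule continuous_on_eq) (simp add: periodization_eq_sum[OF assms(2) D])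
qed

text \<open>
  The lattice point count is a discontinuous periodic function, but it is the pointwise limit of the
  bounded continuous periodizations of functions that are one on the ball and fall off
  linearly to zero on a thin shell around it. Dominated convergence turns this into approximation in
  mean square, and the continuous functions are uniform limits of trigonometric polynomials.
\<close>

lemma cball_count_L2_approx:
  fixes R :: real
  assumes e: "0 < e"
  defines "N \<equiv> periodization (indicator (cball 0 R)) :: real ^ 'n \<Rightarrow> real"
  shows "\<exists>p. trig_polynomial p \<and> (\<integral>u. (norm (complex_of_real (N u) - p u))\<^sup>2 \<partial>uniform_unit_cube) < e"
proof -
  let ?M = "uniform_unit_cube :: (real ^ 'n) measure"
  interpret prob_space ?M by (rule prob_space_uniform_unit_cube)
  define h where "h n x = max 0 (min 1 (1 + real (Suc n) * (R - norm x)))" for n and x :: "real ^ 'n"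
  define \<phi> where "\<phi> n = periodization (h n)" for n
  define \<Gamma> :: "(real ^ 'n) set" where "\<Gamma> = integer_lattice \<inter> cball 0 ((R + 1) + real CARD('n))"
  have h0: "h n x = 0" if "R + 1 < norm x" for n x
  proof -
    have "real (Suc n) * (R - norm x) \<le> 1 * (R - norm x)"
      using that by (intro mult_right_mono_neg) auto
    also have "\<dots> \<le> -1" using that by simp
    finally have "real (Suc n) * (R - norm x) \<le> -1" .
    moreover have "max 0 (min 1 (1 + y)) = 0" if "y \<le> -1" for y :: real using that by simp
    ultimately show ?thesis unfolding h_def by blast
  qed
  have i0: "indicator (cball 0 R) x = (0::real)" if "R + 1 < norm x" for x :: "real ^ 'n"
    using that by simp
  have hc: "continuous_on UNIV (h n)" for n
    unfolding h_def by (intro continuous_intros)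
  have [measurable]: "N \<in> borel_measurable borel"
    unfolding N_def by (rule borel_measurable_periodization[OF borel_measurable_indicator i0]) auto
  have [measurable]: "\<phi> n \<in> borel_measurable borel" for n
    unfolding \<phi>_def by (rule borel_measurable_periodization[OF _ h0])
      (rule borel_measurable_continuous_onI[OF hc])
  have Neq: "N u = (\<Sum>\<gamma>\<in>\<Gamma>. indicator (cball 0 R) (\<gamma> + u))" if "u \<in> unit_cube" for u
    unfolding N_def \<Gamma>_def by (rule periodization_eq_sum[OF i0 norm_unit_cube_le[OF that]])
  have \<phi>eq: "\<phi> n u = (\<Sum>\<gamma>\<in>\<Gamma>. h n (\<gamma> + u))" if "u \<in> unit_cube" for u n
    unfolding \<phi>_def \<Gamma>_def by (rule periodization_eq_sum[OF h0 norm_unit_cube_le[OF that]])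
  have bnd: "\<bar>N u - \<phi> n u\<bar> \<le> real (card \<Gamma>)" if u: "u \<in> unit_cube" for u n
  proof -
    have "\<bar>N u - \<phi> n u\<bar> = \<bar>\<Sum>\<gamma>\<in>\<Gamma>. indicator (cball 0 R) (\<gamma> + u) - h n (\<gamma> + u)\<bar>"
      using u by (simp add: Neq \<phi>eq sum_subtractf)
    also have "\<dots> \<le> (\<Sum>\<gamma>\<in>\<Gamma>. 1)"
      by (rule order_trans[OF sum_abs sum_mono]) (auto simp: h_def indicator_def)
    finally show ?thesis by simp
  qed
  have h_lim: "(\<lambda>n. h n x) \<longlonglongrightarrow> indicator (cball 0 R) x" for x
  proof (cases "norm x \<le> R")
    case True
    then have "h n x = 1" for n by (simp add: h_def)
    then show ?thesis using True by simp
  next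
    case False
    have "\<forall>\<^sub>F n in sequentially. h n x = 0"
    proof -
      obtain m where m: "1 < real m * (norm x - R)"
        using False reals_Archimedean3[of "norm x - R"] by auto
      have "h n x = 0" if "m \<le> n" for n
      proof -
        have "real m * (norm x - R) \<le> real (Suc n) * (norm x - R)"
          using that False by (intro mult_right_mono) auto
        with m have "1 + real (Suc n) * (R - norm x) \<le> 0" by (simp add: algebra_simps)
        then show ?thesis by (simp add: h_def)
      qed
      then show ?thesis by (auto simp: eventually_sequentially)
    qed
    then show ?thesis using False by (simp add: tendsto_eventually)
  qed
  have "(\<lambda>n. \<integral>u. (N u - \<phi> n u)\<^sup>2 \<partial>?M) \<longlonglongrightarrow> (\<integral>u. 0 \<partial>?M)"
  proof (rule integral_dominated_convergence[where w = "\<lambda>_. (real (card \<Gamma>))\<^sup>2"])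
    show "AE u in ?M. (\<lambda>n. (N u - \<phi> n u)\<^sup>2) \<longlonglongrightarrow> 0"
      using AE_uniform_unit_cube
    proof eventually_elim
      fix u :: "real ^ 'n" assume u: "u \<in> unit_cube"
      have "(\<lambda>n. (N u - (\<Sum>\<gamma>\<in>\<Gamma>. h n (\<gamma> + u)))\<^sup>2)
          \<longlonglongrightarrow> (N u - (\<Sum>\<gamma>\<in>\<Gamma>. indicator (cball 0 R) (\<gamma> + u)))\<^sup>2"
        by (intro tendsto_intros h_lim)
      then show "(\<lambda>n. (N u - \<phi> n u)\<^sup>2) \<longlonglongrightarrow> 0" using u by (simp add: \<phi>eq Neq)
    qed
    show "AE u in ?M. norm ((N u - \<phi> n u)\<^sup>2) \<le> (real (card \<Gamma>))\<^sup>2" for n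
      using AE_uniform_unit_cube
    proof eventually_elim
      fix u :: "real ^ 'n" assume "u \<in> unit_cube"
      then show "norm ((N u - \<phi> n u)\<^sup>2) \<le> (real (card \<Gamma>))\<^sup>2"
        using bnd by (simp add: abs_le_square_iff[symmetric])
    qed
  qed simp_all
  then have "\<forall>\<^sub>F n in sequentially. (\<integral>u. (N u - \<phi> n u)\<^sup>2 \<partial>?M) < e / 4"
    using e by (intro order_tendstoD) auto
  then obtain n where n: "(\<integral>u. (N u - \<phi> n u)\<^sup>2 \<partial>?M) < e / 4"
    by (auto simp: eventually_sequentially)
  define d where "d = sqrt (e / 4)"
  have d: "0 < d" "d\<^sup>2 = e / 4" using e by (auto simp: d_def)
  have "continuous_on (cbox 0 (\<chi> i. 1)) (\<phi> n)"
    unfolding \<phi>_def by (rule continuous_on_periodization[OF hc h0 bounded_cbox])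
  then obtain g where g: "trig_polynomial (\<lambda>u. complex_of_real (g u))"
      "\<And>u. u \<in> unit_cube \<Longrightarrow> \<bar>\<phi> n u - g u\<bar> < d"
    using trig_polynomial_dense[of "\<phi> n" d] d(1) periodization_shift[of _ "h n"] unfolding \<phi>_def by blast
  have [measurable]: "g \<in> borel_measurable borel"
  proof -
    have "(\<lambda>u. complex_of_real (g u)) \<in> borel_measurable borel"
      using g(1) by (auto simp: trig_polynomial_def)
    then have "(\<lambda>u. Re (complex_of_real (g u))) \<in> borel_measurable borel" by measurable
    then show ?thesis by simp
  qed
  have i1: "integrable ?M (\<lambda>u. (N u - \<phi> n u)\<^sup>2)"
    by (rule integrable_uniform_unit_cube_bounded[where b = "(real (card \<Gamma>))\<^sup>2"])
      (auto simp: abs_le_square_iff[symmetric] bnd)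
  have "(\<integral>u. (norm (complex_of_real (N u) - complex_of_real (g u)))\<^sup>2 \<partial>?M)
      \<le> (\<integral>u. 2 * (N u - \<phi> n u)\<^sup>2 + 2 * d\<^sup>2 \<partial>?M)"
  proof (rule integral_mono_AE)
    show "AE u in ?M. (norm (complex_of_real (N u) - complex_of_real (g u)))\<^sup>2
        \<le> 2 * (N u - \<phi> n u)\<^sup>2 + 2 * d\<^sup>2"
      using AE_uniform_unit_cube
    proof eventually_elim
      fix u :: "real ^ 'n" assume u: "u \<in> unit_cube"
      have "(N u - g u)\<^sup>2 = ((N u - \<phi> n u) + (\<phi> n u - g u))\<^sup>2" by simp
      also have "\<dots> \<le> 2 * (N u - \<phi> n u)\<^sup>2 + 2 * (\<phi> n u - g u)\<^sup>2"
        using zero_le_power2[of "(N u - \<phi> n u) - (\<phi> n u - g u)"]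
        by (simp add: power2_eq_square algebra_simps)
      also have "(\<phi> n u - g u)\<^sup>2 \<le> d\<^sup>2"
        using g(2)[OF u] d(1) by (simp add: abs_le_square_iff[symmetric])
      finally show "(norm (complex_of_real (N u) - complex_of_real (g u)))\<^sup>2
          \<le> 2 * (N u - \<phi> n u)\<^sup>2 + 2 * d\<^sup>2"
        by (simp flip: of_real_diff)
    qed
    show "integrable ?M (\<lambda>u. (norm (complex_of_real (N u) - complex_of_real (g u)))\<^sup>2)"
    proof (rule integrable_uniform_unit_cube_bounded[where b = "(real (card \<Gamma>) + d)\<^sup>2"])
      fix u :: "real ^ 'n" assume u: "u \<in> unit_cube"
      have "\<bar>N u - g u\<bar> \<le> real (card \<Gamma>) + d" using bnd[OF u, of n] g(2)[OF u] by linarith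
      then show "norm ((norm (complex_of_real (N u) - complex_of_real (g u)))\<^sup>2) \<le> (real (card \<Gamma>) + d)\<^sup>2"
        using power_mono[of "\<bar>N u - g u\<bar>" "real (card \<Gamma>) + d" 2]
        by (simp flip: of_real_diff)
    qed measurable
  qed (use i1 in auto)
  also have "\<dots> = 2 * (\<integral>u. (N u - \<phi> n u)\<^sup>2 \<partial>?M) + 2 * d\<^sup>2"
    using i1 prob_space by simp
  also have "\<dots> < e" using n d by simp
  finally show ?thesis using g(1) by blast
qed

section \<open>The number variance as a sum over frequencies\<close>

lemma measure_shifted_lattice_measure:
  fixes u :: "real ^ 'n"
  shows "measure (shifted_lattice_measure u) (cball 0 R) = periodization (indicator (cball 0 R)) u"
proof -
  let ?F = "{\<gamma> \<in> integer_lattice. \<gamma> + u \<in> cball 0 R}"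
  have "?F \<subseteq> integer_lattice \<inter> cball 0 (R + norm u)"
  proof
    fix \<gamma> assume "\<gamma> \<in> ?F"
    then show "\<gamma> \<in> integer_lattice \<inter> cball 0 (R + norm u)"
      using norm_triangle_ineq4[of "\<gamma> + u" u] by simp
  qed
  then have fin: "finite ?F"
    using finite_integer_lattice_bounded[OF bounded_cball] finite_subset by blast
  have "emeasure (shifted_lattice_measure u) (cball 0 R) = emeasure (count_space integer_lattice) ?F"
    by (simp add: shifted_lattice_measure_def emeasure_distr vimage_def Int_def conj_commute)
  also have "\<dots> = ennreal (real (card ?F))"
    using fin by (subst emeasure_count_space_finite) (auto simp: ennreal_of_nat_eq_real_of_nat)
  finally have "measure (shifted_lattice_measure u) (cball 0 R) = real (card ?F)"
    by (simp add: measure_def)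
  also have "\<dots> = (\<Sum>\<^sub>\<infinity>\<gamma>\<in>?F. 1)" using fin by simp
  also have "\<dots> = periodization (indicator (cball 0 R)) u"
    unfolding periodization_def by (rule infsum_cong_neutral) auto
  finally show ?thesis .
qed

lemma borel_measurable_measure_random_measure_algebra:
  assumes "A \<in> sets borel"
  shows "(\<lambda>M. measure M A) \<in> borel_measurable random_measure_algebra"
proof -
  have "(\<lambda>M. emeasure M A) \<in> borel_measurable random_measure_algebra"
    unfolding random_measure_algebra_def
    by (rule measurable_SUP1[OF assms measurable_vimage_algebra1]) auto
  then show ?thesis unfolding measure_def by measurable
qed

lemma number_variance_shifted_lattice_law:
  fixes R :: real
  defines "N \<equiv> periodization (indicator (cball 0 R)) :: real ^ 'n \<Rightarrow> real"
  shows "number_variance (shifted_lattice_law :: (real ^ 'n) measure measure) R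
    = (\<integral>u. (N u - (\<integral>v. N v \<partial>uniform_unit_cube))\<^sup>2 \<partial>uniform_unit_cube)"
proof -
  let ?X = "\<lambda>M :: (real ^ 'n) measure. measure M (cball 0 R)"
  have [measurable]: "?X \<in> borel_measurable random_measure_algebra"
    by (rule borel_measurable_measure_random_measure_algebra) simp
  have [measurable]: "shifted_lattice_measure \<in> measurable (uniform_unit_cube :: (real ^ 'n) measure) random_measure_algebra"
    by (rule measurable_shifted_lattice_measure)
  have *: "(\<integral>M. g (?X M) \<partial>shifted_lattice_law) = (\<integral>u. g (N u) \<partial>uniform_unit_cube)"
    if [measurable]: "g \<in> borel_measurable borel" for g :: "real \<Rightarrow> real"
    unfolding shifted_lattice_law_def
    by (subst integral_distr) (simp_all add: measure_shifted_lattice_measure N_def)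
  show ?thesis
    unfolding number_variance_def using *[of "\<lambda>x. x"] *[of "\<lambda>x. (x - (\<integral>v. N v \<partial>uniform_unit_cube))\<^sup>2"]
    by simp
qed

definition cball_transform :: "real \<Rightarrow> real ^ 'n \<Rightarrow> complex" where
  "cball_transform R k = (\<integral>x. indicator (cball 0 R) x *\<^sub>R cnj (character k x) \<partial>lborel)"

text \<open>
  Characters with integral frequency are periodic, so that multiplication by them commutes with
  periodization; then the integral over the cube unfolds to one over space.
\<close>

lemma fourier_coeff_cball_count:
  assumes k: "k \<in> integer_lattice"
  shows "fourier_coeff (\<lambda>u. complex_of_real (periodization (indicator (cball 0 R)) u)) k = cball_transform R k"
proof -
  let ?h = "\<lambda>x. indicator (cball 0 R) x *\<^sub>R cnj (character k x)"
  have "complex_of_real (periodization (indicator (cball 0 R)) u) * cnj (character k u) = periodization ?h u" for u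
  proof -
    have "complex_of_real (periodization (indicator (cball 0 R)) u)
        = (\<Sum>\<gamma>\<in>integer_lattice \<inter> cball 0 (R + norm u). complex_of_real (indicator (cball 0 R) (\<gamma> + u)))"
      by (subst periodization_eq_sum[where r = R and D = "norm u"]) auto
    moreover have "periodization ?h u
        = (\<Sum>\<gamma>\<in>integer_lattice \<inter> cball 0 (R + norm u). ?h (\<gamma> + u))"
      by (subst periodization_eq_sum[where r = R and D = "norm u"]) auto
    moreover have "?h (\<gamma> + u) = complex_of_real (indicator (cball 0 R) (\<gamma> + u)) * cnj (character k u)"
      if "\<gamma> \<in> integer_lattice" for \<gamma>
      by (simp add: character_shift[OF k that] scaleR_conv_of_real)
    ultimately show ?thesis by (simp add: sum_distrib_right)
  qed
  then have "fourier_coeff (\<lambda>u. complex_of_real (periodization (indicator (cball 0 R)) u)) k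
      = (\<integral>u. periodization ?h u \<partial>uniform_unit_cube)"
    by (simp add: fourier_coeff_def)
  also have "\<dots> = (\<integral>x. ?h x \<partial>lborel)"
  proof (rule integral_periodization)
    show "integrable lborel ?h"
      by (rule integrableI_bounded_set_indicator[of _ _ _ 1])
        (auto simp: emeasure_bounded_finite[simplified] cnj_character split: split_indicator)
    show "?h x = 0" if "R < norm x" for x using that by simp
  qed
  finally show ?thesis by (simp add: cball_transform_def)
qed

text \<open>
  The variance is the squared norm of the count minus its squared mean, and the mean is the Fourier
  coefficient at frequency zero. Hence the nonzero frequencies alone account for the variance.
\<close>

lemma number_variance_le_sum:
  assumes e: "0 < e"
  shows "\<exists>S :: (real ^ 'n) set. finite S \<and> S \<subseteq> integer_lattice - {0} \<and>
    number_variance (shifted_lattice_law :: (real ^ 'n) measure measure) R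
      \<le> (\<Sum>k\<in>S. (norm (cball_transform R k))\<^sup>2) + e"
proof -
  let ?M = "uniform_unit_cube :: (real ^ 'n) measure"
  interpret prob_space ?M by (rule prob_space_uniform_unit_cube)
  define N :: "real ^ 'n \<Rightarrow> real" where "N = periodization (indicator (cball 0 R))"
  have i0: "indicator (cball 0 R) x = (0::real)" if "R < norm x" for x :: "real ^ 'n"
    using that by simp
  have [measurable]: "N \<in> borel_measurable borel"
    unfolding N_def by (rule borel_measurable_periodization[OF borel_measurable_indicator i0]) auto
  define b where "b = real (card (integer_lattice \<inter> cball 0 (R + real CARD('n)) :: (real ^ 'n) set))"
  have b: "\<bar>N u\<bar> \<le> b" if u: "u \<in> unit_cube" for u
  proof -
    have "N u = (\<Sum>\<gamma>\<in>integer_lattice \<inter> cball 0 (R + real CARD('n)). indicator (cball 0 R) (\<gamma> + u))"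
      unfolding N_def by (rule periodization_eq_sum[OF i0 norm_unit_cube_le[OF u]])
    also have "\<bar>\<dots>\<bar> \<le> (\<Sum>\<gamma>\<in>(integer_lattice \<inter> cball 0 (R + real CARD('n)) :: (real ^ 'n) set). 1)"
      by (rule order_trans[OF sum_abs sum_mono]) (auto simp: indicator_def)
    finally show ?thesis by (simp add: b_def)
  qed
  have i1: "integrable ?M N" by (rule integrable_uniform_unit_cube_bounded[where b = b]) (auto simp: b)
  have i2: "integrable ?M (\<lambda>u. (N u)\<^sup>2)"
    by (rule integrable_uniform_unit_cube_bounded[where b = "b\<^sup>2"])
      (auto intro: power_mono[OF b, where n = 2, simplified])
  let ?V = "\<integral>u. N u \<partial>?M"
  have V: "fourier_coeff (\<lambda>u. complex_of_real (N u)) 0 = complex_of_real ?V"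
    by (simp add: fourier_coeff_def)
  obtain p where p: "trig_polynomial p" "(\<integral>u. (norm (complex_of_real (N u) - p u))\<^sup>2 \<partial>?M) < e"
    using cball_count_L2_approx[OF e, of R] unfolding N_def by blast
  obtain S c where S: "finite S" "S \<subseteq> integer_lattice" "p = (\<lambda>u. \<Sum>k\<in>S. c k * character k u)"
    using p(1) by (auto simp: trig_polynomial_def)
  let ?F = "\<lambda>k. (norm (fourier_coeff (\<lambda>u. complex_of_real (N u)) k))\<^sup>2"
  have "(\<integral>u. (N u)\<^sup>2 \<partial>?M) \<le> (\<Sum>k\<in>S. ?F k) + e"
    using L2_norm_le_fourier_coeff[of "\<lambda>u. complex_of_real (N u)" b S p c] b S p(2) by simp
  also have "(\<Sum>k\<in>S. ?F k) \<le> (\<Sum>k\<in>insert 0 (S - {0}). ?F k)"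
    using S by (intro sum_mono2) auto
  also have "\<dots> = ?V\<^sup>2 + (\<Sum>k\<in>S - {0}. (norm (cball_transform R k))\<^sup>2)"
  proof -
    have "(\<Sum>k\<in>S - {0}. ?F k) = (\<Sum>k\<in>S - {0}. (norm (cball_transform R k))\<^sup>2)"
      unfolding N_def using S by (intro sum.cong refl) (subst fourier_coeff_cball_count, auto)
    then show ?thesis using S(1) by (simp add: V del: insert_Diff_single)
  qed
  finally have "(\<integral>u. (N u)\<^sup>2 \<partial>?M) - ?V\<^sup>2 \<le> (\<Sum>k\<in>S - {0}. (norm (cball_transform R k))\<^sup>2) + e" by simp
  moreover have "number_variance (shifted_lattice_law :: (real ^ 'n) measure measure) R
      = (\<integral>u. (N u)\<^sup>2 \<partial>?M) - ?V\<^sup>2"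
    unfolding number_variance_shifted_lattice_law N_def[symmetric]
    using variance_eq[OF i1 i2] .
  ultimately show ?thesis
    using S by (intro exI[of _ "S - {0}"]) auto
qed

section \<open>The Fourier transform of the five-dimensional ball\<close>

text \<open>
  The slice of the ball at height \<open>t\<close> along a coordinate axis is a ball of radius \<open>sqrt (R\<^sup>2 - t\<^sup>2)\<close>
  in one dimension less. The orthogonal complement of the axis is not a type, so the slices are measured
  in the product of the remaining coordinates.
\<close>

lemma emeasure_cball_slice:
  fixes b :: "'a::euclidean_space"
  assumes b: "b \<in> Basis" and R: "0 < R" and [measurable]: "A \<in> sets borel"
  shows "emeasure lborel {x \<in> cball 0 R. x \<bullet> b \<in> A}
    = (\<integral>\<^sup>+ t. indicator A t * ennreal (indicator {-R..R} t *
        (unit_ball_vol (real (DIM('a) - 1)) * sqrt (R\<^sup>2 - t\<^sup>2) ^ (DIM('a) - 1))) \<partial>lborel)"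
proof -
  interpret product_sigma_finite "\<lambda>_. lborel :: real measure" by standard
  define B where "B = Basis - {b}"
  have B: "finite B" "b \<notin> B" "Basis = insert b B" "card B = DIM('a) - 1"
    using b by (auto simp: B_def)
  let ?y = "\<lambda>f. \<Sum>i\<in>Basis. f i *\<^sub>R i :: 'a"
  let ?S = "{x \<in> cball 0 R. x \<bullet> b \<in> A}"
  let ?D = "\<lambda>t. {f. sqrt (\<Sum>i\<in>B. (f i)\<^sup>2) \<le> sqrt (R\<^sup>2 - t\<^sup>2)} \<inter> space (Pi\<^sub>M B (\<lambda>_. lborel :: real measure))"
  have [measurable]: "?S \<in> sets borel" by measurable
  have "emeasure lborel ?S = (\<integral>\<^sup>+ x. indicator ?S x \<partial>distr (Pi\<^sub>M Basis (\<lambda>_. lborel)) borel ?y)"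
    by (simp flip: lborel_eq)
  also have "\<dots> = (\<integral>\<^sup>+ f. indicator ?S (?y f) \<partial>Pi\<^sub>M (insert b B) (\<lambda>_. lborel))"
    by (subst nn_integral_distr) (simp_all flip: B(3))
  also have "\<dots> = (\<integral>\<^sup>+ t. \<integral>\<^sup>+ f. indicator ?S (?y (f(b := t))) \<partial>Pi\<^sub>M B (\<lambda>_. lborel) \<partial>lborel)"
    using B by (intro product_nn_integral_insert_rev) (simp_all flip: B(3))
  also have "\<dots> = (\<integral>\<^sup>+ t. \<integral>\<^sup>+ f. indicator A t * indicator {-R..R} t * indicator (?D t) f
      \<partial>Pi\<^sub>M B (\<lambda>_. lborel) \<partial>lborel)"
  proof (intro nn_integral_cong)
    fix t and f :: "'a \<Rightarrow> real" assume f: "f \<in> space (Pi\<^sub>M B (\<lambda>_. lborel))"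
    have yi: "?y (f(b := t)) \<bullet> i = (f(b := t)) i" if "i \<in> Basis" for i
      using that by simp
    have "norm (?y (f(b := t))) = sqrt (\<Sum>i\<in>Basis. ((f(b := t)) i)\<^sup>2)"
      unfolding norm_conv_dist by (subst euclidean_dist_l2) (simp add: L2_set_def)
    also have "(\<Sum>i\<in>Basis. ((f(b := t)) i)\<^sup>2) = t\<^sup>2 + (\<Sum>i\<in>B. ((f(b := t)) i)\<^sup>2)"
      unfolding B(3) using B(1,2) by simp
    also have "(\<Sum>i\<in>B. ((f(b := t)) i)\<^sup>2) = (\<Sum>i\<in>B. (f i)\<^sup>2)"
      using B by (intro sum.cong) auto
    finally have n: "norm (?y (f(b := t))) = sqrt (t\<^sup>2 + (\<Sum>i\<in>B. (f i)\<^sup>2))" .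
    have "0 \<le> (\<Sum>i\<in>B. (f i)\<^sup>2)" by (simp add: sum_nonneg)
    then have "norm (?y (f(b := t))) \<le> R \<longleftrightarrow> t \<in> {-R..R} \<and> (\<Sum>i\<in>B. (f i)\<^sup>2) \<le> R\<^sup>2 - t\<^sup>2"
      using R abs_le_square_iff[of t R] unfolding n by (auto simp: real_sqrt_le_iff' abs_le_iff)
    then show "indicator ?S (?y (f(b := t))) = indicator A t * indicator {-R..R} t * (indicator (?D t) f :: ennreal)"
      using f yi[OF b] by (simp add: indicator_def) blast
  qed
  also have "\<dots> = (\<integral>\<^sup>+ t. indicator A t * ennreal (indicator {-R..R} t *
        (unit_ball_vol (real (DIM('a) - 1)) * sqrt (R\<^sup>2 - t\<^sup>2) ^ (DIM('a) - 1))) \<partial>lborel)"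
  proof (rule nn_integral_cong_AE)
    \<comment> \<open>At the two poles the slice is a point, and the volume formula for balls of positive radius
      does not cover it.\<close>
    have "AE t in lborel. t \<notin> {-R, R}"
      by (intro AE_not_in countable_imp_null_set_lborel) auto
    then show "AE t in lborel. (\<integral>\<^sup>+ f. indicator A t * indicator {-R..R} t * indicator (?D t) f \<partial>Pi\<^sub>M B (\<lambda>_. lborel))
      = indicator A t * ennreal (indicator {-R..R} t *
        (unit_ball_vol (real (DIM('a) - 1)) * sqrt (R\<^sup>2 - t\<^sup>2) ^ (DIM('a) - 1)))"
    proof eventually_elim
      fix t :: real assume t: "t \<notin> {-R, R}"
      show "(\<integral>\<^sup>+ f. indicator A t * indicator {-R..R} t * indicator (?D t) f \<partial>Pi\<^sub>M B (\<lambda>_. lborel))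
        = indicator A t * ennreal (indicator {-R..R} t *
          (unit_ball_vol (real (DIM('a) - 1)) * sqrt (R\<^sup>2 - t\<^sup>2) ^ (DIM('a) - 1)))"
      proof (cases "t \<in> {-R<..<R}")
        case True
        then have "t\<^sup>2 < R\<^sup>2" by (subst real_sqrt_less_iff [symmetric]) auto
        then have "emeasure (Pi\<^sub>M B (\<lambda>_. lborel)) (?D t)
            = ennreal (unit_ball_vol (real (DIM('a) - 1)) * sqrt (R\<^sup>2 - t\<^sup>2) ^ (DIM('a) - 1))"
          using emeasure_cball_aux[of B "sqrt (R\<^sup>2 - t\<^sup>2)"] B by simp
        then show ?thesis
          using True B(1) by (subst nn_integral_cmult, simp, subst nn_integral_indicator) auto
      qed (use t in \<open>auto simp: indicator_def\<close>)
    qed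
  qed
  finally show ?thesis .
qed

lemma emeasure_cball_inner_rotate:
  fixes v w :: "real ^ 'n::{finite, wellorder}"
  assumes w: "norm w = norm v" and [measurable]: "A \<in> sets borel"
  shows "emeasure lborel {x \<in> cball 0 R. x \<bullet> v \<in> A} = emeasure lborel {x \<in> cball 0 R. x \<bullet> w \<in> A}"
proof -
  let ?S = "\<lambda>v. {x \<in> cball 0 R. x \<bullet> v \<in> A}"
  obtain f where f: "orthogonal_transformation f" "f w = v"
    using orthogonal_transformation_exists[OF w] .
  have sets: "?S v \<in> sets borel" for v :: "real ^ 'n::_" by measurable
  have lm: "?S v \<in> lmeasurable" for v :: "real ^ 'n::_"
    using sets[of v] by (intro bounded_set_imp_lmeasurable bounded_subset[OF bounded_cball, of _ 0 R]) auto
  have "f ` ?S w = ?S v"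
  proof safe
    fix y assume "y \<in> cball 0 R" "y \<bullet> w \<in> A"
    then show "f y \<in> cball 0 R" "f y \<bullet> v \<in> A"
      using f by (simp_all add: orthogonal_transformation_norm) (metis f orthogonal_transformation_def)
  next
    fix x assume x: "x \<in> cball 0 R" "x \<bullet> v \<in> A"
    obtain y where y: "x = f y"
      using orthogonal_transformation_surj[OF f(1)] by (metis surjD)
    then have "y \<bullet> w \<in> A" "norm y = norm x"
      using x f by (metis orthogonal_transformation_def, metis f(1) orthogonal_transformation_norm)
    then show "x \<in> f ` ?S w" using x y by auto
  qed
  then have "measure lebesgue (?S v) = measure lebesgue (?S w)"
    using measure_orthogonal_image[OF f(1) lm[of w]] by simp
  then have "emeasure lebesgue (?S v) = emeasure lebesgue (?S w)"
    using lm by (simp add: emeasure_eq_measure2 fmeasurableD2)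
  then show ?thesis using sets by simp
qed

text \<open>
  The projection of Lebesgue measure on the ball to a line through the centre has the volume of
  the slices as its density. This reduces the Fourier transform of the ball to a one-dimensional
  integral.
\<close>

lemma integral_cball_inner:
  fixes v :: "real ^ 'n::{finite, wellorder}" and g :: "real \<Rightarrow> complex"
  assumes v: "norm v = 1" and R: "0 < R" and g [measurable]: "g \<in> borel_measurable borel"
  shows "(\<integral>x. indicator (cball 0 R) x *\<^sub>R g (x \<bullet> v) \<partial>lborel)
    = (\<integral>t. (indicator {-R..R} t * (unit_ball_vol (real (CARD('n) - 1)) * sqrt (R\<^sup>2 - t\<^sup>2) ^ (CARD('n) - 1))) *\<^sub>R g t \<partial>lborel)"
proof -
  let ?M = "density lborel (\<lambda>x. ennreal (indicator (cball 0 R) (x :: real ^ 'n::_)))"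
  let ?d = "\<lambda>t. indicator {-R..R} t * (unit_ball_vol (real (CARD('n) - 1)) * sqrt (R\<^sup>2 - t\<^sup>2) ^ (CARD('n) - 1))"
  have [measurable]: "cball (0 :: real ^ 'n::_) R \<in> sets borel" by simp
  have d0: "0 \<le> ?d t" for t
    using R abs_le_square_iff[of t R] by (auto simp: indicator_def abs_le_iff)
  have eq: "distr ?M borel (\<lambda>x. x \<bullet> v) = density lborel (\<lambda>t. ennreal (?d t))"
  proof (rule measure_eqI)
    fix A assume "A \<in> sets (distr ?M borel (\<lambda>x. x \<bullet> v))"
    then have A [measurable]: "A \<in> sets borel" by simp
    obtain b :: "real ^ 'n::_" where b: "b \<in> Basis" using nonempty_Basis by blast
    have [measurable]: "{x. x \<bullet> v \<in> A} \<in> sets borel" by measurable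
    have "emeasure (distr ?M borel (\<lambda>x. x \<bullet> v)) A
        = (\<integral>\<^sup>+ x. ennreal (indicator (cball 0 R) x) * indicator {x. x \<bullet> v \<in> A} x \<partial>lborel)"
      by (simp add: emeasure_distr vimage_def) (rule emeasure_density; measurable)
    also have "\<dots> = (\<integral>\<^sup>+ x. indicator {x \<in> cball 0 R. x \<bullet> v \<in> A} x \<partial>lborel)"
      by (intro nn_integral_cong) (simp add: indicator_def)
    also have "\<dots> = emeasure lborel {x \<in> cball 0 R. x \<bullet> v \<in> A}"
      by (rule nn_integral_indicator) measurable
    also have "\<dots> = emeasure lborel {x \<in> cball 0 R. x \<bullet> b \<in> A}"
      using v b by (intro emeasure_cball_inner_rotate) auto
    also have "\<dots> = (\<integral>\<^sup>+ t. indicator A t * ennreal (?d t) \<partial>lborel)"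
      using emeasure_cball_slice[OF b R A] by simp
    also have "\<dots> = emeasure (density lborel (\<lambda>t. ennreal (?d t))) A"
      by (simp add: emeasure_density mult.commute)
    finally show "emeasure (distr ?M borel (\<lambda>x. x \<bullet> v)) A = emeasure (density lborel (\<lambda>t. ennreal (?d t))) A" .
  qed simp
  have "(\<integral>x. indicator (cball 0 R) x *\<^sub>R g (x \<bullet> v) \<partial>lborel) = (\<integral>x. g (x \<bullet> v) \<partial>?M)"
    by (rule integral_density[symmetric]) measurable
  also have "\<dots> = (\<integral>t. g t \<partial>distr ?M borel (\<lambda>x. x \<bullet> v))"
    by (rule integral_distr[symmetric]) simp_all
  also have "\<dots> = (\<integral>t. ?d t *\<^sub>R g t \<partial>lborel)"
    unfolding eq using d0 by (intro integral_density) simp_all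
  finally show ?thesis .
qed

text \<open>
  Repeated integration by parts. The polynomial \<open>(R\<^sup>2 - t\<^sup>2)\<^sup>2\<close> and its first derivative vanish at
  \<open>t = R\<close> and \<open>t = - R\<close>, which is why no term in \<open>1 / w\<close> or \<open>1 / w\<^sup>2\<close> survives.
\<close>

lemma integral_quartic_exp:
  fixes a R :: real
  assumes a: "a \<noteq> 0" and R: "0 < R"
  defines "w \<equiv> - \<i> * complex_of_real a"
  shows "(\<integral>t. indicator {-R..R} t *\<^sub>R (complex_of_real ((R\<^sup>2 - t\<^sup>2)\<^sup>2) * exp (w * complex_of_real t)) \<partial>lborel)
    = 8 * complex_of_real R ^ 2 / w ^ 3 * (exp (w * R) - exp (- (w * R)))
      - 24 * complex_of_real R / w ^ 4 * (exp (w * R) + exp (- (w * R)))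
      + 24 / w ^ 5 * (exp (w * R) - exp (- (w * R)))"
proof -
  have w: "w \<noteq> 0" using a by (simp add: w_def)
  define r where "r = complex_of_real R"
  define c where "c = 1 / w"
  have wc: "w * c = 1" using w by (simp add: c_def)
  \<comment> \<open>The alternating sum of the derivatives of the polynomial, divided by increasing powers of w;
    it solves w Q + Q' = (r^2 - z^2)^2.\<close>
  define Q where "Q z = c * (r\<^sup>2 - z\<^sup>2)\<^sup>2 + 4 * c ^ 2 * (z * (r\<^sup>2 - z\<^sup>2)) + c ^ 3 * (12 * z\<^sup>2 - 4 * r\<^sup>2)
    - 24 * c ^ 4 * z + 24 * c ^ 5" for z
  define Q' where "Q' z = c * (- 4 * z * (r\<^sup>2 - z\<^sup>2)) + 4 * c ^ 2 * (r\<^sup>2 - 3 * z\<^sup>2) + 24 * c ^ 3 * z - 24 * c ^ 4" for z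
  define G where "G z = exp (w * z) * Q z" for z
  have Q: "(Q has_field_derivative Q' z) (at z)" for z
    unfolding Q_def Q'_def
    by (auto intro!: derivative_eq_intros simp: algebra_simps power2_eq_square)
  have G: "(G has_field_derivative (r\<^sup>2 - z\<^sup>2)\<^sup>2 * exp (w * z)) (at z)" for z
  proof -
    have "((\<lambda>z. exp (w * z)) has_field_derivative w * exp (w * z)) (at z)"
      by (auto intro!: derivative_eq_intros)
    from DERIV_mult[OF this Q]
    have "(G has_field_derivative exp (w * z) * (w * Q z + Q' z)) (at z)"
      unfolding G_def by (simp add: algebra_simps)
    moreover have "w * Q z + Q' z = (r\<^sup>2 - z\<^sup>2)\<^sup>2"
      using wc unfolding Q_def Q'_def by algebra
    ultimately show ?thesis by (simp add: mult.commute)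
  qed
  have "(\<integral>t. indicator {-R..R} t *\<^sub>R (complex_of_real ((R\<^sup>2 - t\<^sup>2)\<^sup>2) * exp (w * complex_of_real t)) \<partial>lborel)
      = G (complex_of_real R) - G (complex_of_real (- R))"
  proof (rule integral_FTC_Icc)
    fix t
    have "((\<lambda>t. G (complex_of_real t)) has_vector_derivative
        (r\<^sup>2 - (complex_of_real t)\<^sup>2)\<^sup>2 * exp (w * complex_of_real t)) (at t within {- R..R})"
      by (rule has_vector_derivative_real_field[OF G])
    then show "((\<lambda>t. G (complex_of_real t)) has_vector_derivative
        complex_of_real ((R\<^sup>2 - t\<^sup>2)\<^sup>2) * exp (w * complex_of_real t)) (at t within {- R..R})"
      by (simp add: r_def)
  qed (use R in \<open>auto intro!: continuous_intros\<close>)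
  also have "\<dots> = 8 * r ^ 2 / w ^ 3 * (exp (w * r) - exp (- (w * r)))
      - 24 * r / w ^ 4 * (exp (w * r) + exp (- (w * r)))
      + 24 / w ^ 5 * (exp (w * r) - exp (- (w * r)))"
    by (simp add: G_def Q_def c_def power_divide algebra_simps add_divide_distrib diff_divide_distrib flip: r_def)
  finally show ?thesis by (simp add: r_def)
qed

text \<open>
  In dimension five the slice volume is a multiple of \<open>(R\<^sup>2 - t\<^sup>2)\<^sup>2\<close>. The leading term of the
  transform is then of order \<open>R\<^sup>2 / |k| ^ 3\<close> times the sine of \<open>2 \<pi> |k| R\<close> without a phase shift, so
  it vanishes when \<open>|k| R\<close> is an integer.
\<close>

lemma norm_cball_transform_le:
  fixes k :: "real ^ 5"
  assumes k: "1 \<le> norm k" and R: "1 \<le> R"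
  defines "a \<equiv> 2 * pi * norm k"
  shows "norm (cball_transform R k) \<le> unit_ball_vol 4 * 96 * R\<^sup>2 / norm k ^ 3 * (\<bar>sin (a * R)\<bar> + 1 / R)"
proof -
  define w where "w = - \<i> * complex_of_real a"
  have ak: "norm k \<le> a" and a: "1 \<le> a"
  proof -
    have "1 * norm k \<le> (2 * pi) * norm k"
      using pi_ge_two by (intro mult_right_mono) auto
    then show "norm k \<le> a" by (simp add: a_def)
    then show "1 \<le> a" using k by simp
  qed
  define v where "v = k /\<^sub>R norm k"
  have "k \<noteq> 0" using k by auto
  then have v: "norm v = 1" "k = norm k *\<^sub>R v" by (simp_all add: v_def)
  have "cball_transform R k = (\<integral>x. indicator (cball 0 R) x *\<^sub>R exp (w * complex_of_real (x \<bullet> v)) \<partial>lborel)"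
  proof -
    have "cnj (character k x) = exp (w * complex_of_real (x \<bullet> v))" for x
    proof -
      have "k \<bullet> x = norm k * (x \<bullet> v)" by (subst v(2)) (simp add: inner_commute)
      then show ?thesis
        by (simp add: character_def cis_conv_exp w_def a_def exp_cnj mult_ac)
    qed
    then show ?thesis by (simp add: cball_transform_def)
  qed
  also have "\<dots> = (\<integral>t. (indicator {-R..R} t * (unit_ball_vol 4 * sqrt (R\<^sup>2 - t\<^sup>2) ^ 4)) *\<^sub>R
      exp (w * complex_of_real t) \<partial>lborel)"
    using R by (subst integral_cball_inner[OF v(1)]) (simp_all add: borel_measurable_continuous_onI continuous_intros)
  also have "\<dots> = (\<integral>t. complex_of_real (unit_ball_vol 4) * (indicator {-R..R} t *\<^sub>R
      (complex_of_real ((R\<^sup>2 - t\<^sup>2)\<^sup>2) * exp (w * complex_of_real t))) \<partial>lborel)"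
  proof (intro Bochner_Integration.integral_cong refl)
    fix t
    have "sqrt (R\<^sup>2 - t\<^sup>2) ^ 4 = (R\<^sup>2 - t\<^sup>2)\<^sup>2" if "t \<in> {-R..R}"
    proof -
      have "sqrt (R\<^sup>2 - t\<^sup>2) ^ 4 = ((sqrt (R\<^sup>2 - t\<^sup>2))\<^sup>2)\<^sup>2" by simp
      also have "(sqrt (R\<^sup>2 - t\<^sup>2))\<^sup>2 = R\<^sup>2 - t\<^sup>2"
        using that abs_le_square_iff[of t R] R by (simp add: abs_le_iff)
      finally show ?thesis .
    qed
    then show "(indicator {-R..R} t * (unit_ball_vol 4 * sqrt (R\<^sup>2 - t\<^sup>2) ^ 4)) *\<^sub>R exp (w * complex_of_real t)
      = complex_of_real (unit_ball_vol 4) * (indicator {-R..R} t *\<^sub>R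
      (complex_of_real ((R\<^sup>2 - t\<^sup>2)\<^sup>2) * exp (w * complex_of_real t)))"
      by (cases "t \<in> {-R..R}") (simp_all add: scaleR_conv_of_real)
  qed
  also have "\<dots> = complex_of_real (unit_ball_vol 4) *
     (8 * complex_of_real R ^ 2 / w ^ 3 * (exp (w * R) - exp (- (w * R)))
      - 24 * complex_of_real R / w ^ 4 * (exp (w * R) + exp (- (w * R)))
      + 24 / w ^ 5 * (exp (w * R) - exp (- (w * R))))"
  proof -
    have "a \<noteq> 0" "0 < R" using a R by auto
    from integral_quartic_exp[OF this, folded w_def] show ?thesis
      by (simp only: integral_mult_right_zero)
  qed
  finally have "norm (cball_transform R k) = unit_ball_vol 4 * norm
     (8 * complex_of_real R ^ 2 / w ^ 3 * (exp (w * R) - exp (- (w * R)))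
      - 24 * complex_of_real R / w ^ 4 * (exp (w * R) + exp (- (w * R)))
      + 24 / w ^ 5 * (exp (w * R) - exp (- (w * R))))"
    by (simp add: norm_mult)
  also have "norm (8 * complex_of_real R ^ 2 / w ^ 3 * (exp (w * R) - exp (- (w * R)))
      - 24 * complex_of_real R / w ^ 4 * (exp (w * R) + exp (- (w * R)))
      + 24 / w ^ 5 * (exp (w * R) - exp (- (w * R))))
    \<le> 8 * R ^ 2 / a ^ 3 * (2 * \<bar>sin (a * R)\<bar>) + 24 * R / a ^ 4 * 2 + 24 / a ^ 5 * 2"
  proof -
    have nw: "norm w = a" using a by (simp add: w_def norm_mult)
    have e: "exp (w * R) = cis (- (a * R))" "exp (- (w * R)) = cis (a * R)"
      by (simp_all add: cis_conv_exp w_def mult_ac)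
    have "cis (- (a * R)) - cis (a * R) = - 2 * \<i> * complex_of_real (sin (a * R))"
      by (simp add: complex_eq_iff)
    then have m: "norm (exp (w * R) - exp (- (w * R))) = 2 * \<bar>sin (a * R)\<bar>"
      unfolding e by (simp add: norm_mult)
    have m2: "norm (exp (w * R) - exp (- (w * R))) \<le> 2" "norm (exp (w * R) + exp (- (w * R))) \<le> 2"
      unfolding e by (rule norm_triangle_le_diff norm_triangle_le; simp)+
    have "norm (8 * complex_of_real R ^ 2 / w ^ 3 * (exp (w * R) - exp (- (w * R)))) = 8 * R ^ 2 / a ^ 3 * (2 * \<bar>sin (a * R)\<bar>)"
      using m nw R by (simp add: norm_mult norm_divide norm_power)
    moreover have "norm (24 * complex_of_real R / w ^ 4 * (exp (w * R) + exp (- (w * R)))) \<le> 24 * R / a ^ 4 * 2"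
      unfolding norm_mult[of _ "_ + _"] using m2(2) nw R a
      by (intro mult_mono) (auto simp: norm_mult norm_divide norm_power)
    moreover have "norm (24 / w ^ 5 * (exp (w * R) - exp (- (w * R)))) \<le> 24 / a ^ 5 * 2"
      unfolding norm_mult[of _ "_ - _"] using m2(1) nw a
      by (intro mult_mono) (auto simp: norm_divide norm_power)
    ultimately show ?thesis
      by (intro norm_triangle_le[of _ _ "_ + _"] add_mono order_trans[OF norm_triangle_ineq4]) auto
  qed
  also have "\<dots> \<le> 96 * R\<^sup>2 / a ^ 3 * (\<bar>sin (a * R)\<bar> + 1 / R)"
  proof -
    have "1 / a ^ 4 \<le> 1 / a ^ 3" "1 / a ^ 5 \<le> 1 / a ^ 3"
      using a by (auto intro!: divide_left_mono power_increasing mult_pos_pos)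
    then have "R * (48 * (1 / a ^ 4)) \<le> R * (48 * (1 / a ^ 3))" "48 * (1 / a ^ 5) * 1 \<le> 48 * (1 / a ^ 3) * R"
      using R a by (intro mult_left_mono mult_mono; simp)+
    moreover have "8 * R ^ 2 * (2 * \<bar>sin (a * R)\<bar>) / a ^ 3 \<le> 96 * R\<^sup>2 * \<bar>sin (a * R)\<bar> / a ^ 3"
      using a by (intro divide_right_mono) auto
    moreover have "96 * R\<^sup>2 / a ^ 3 * (\<bar>sin (a * R)\<bar> + 1 / R) = 96 * R\<^sup>2 * \<bar>sin (a * R)\<bar> / a ^ 3 + 96 * R / a ^ 3"
      using R a by (simp add: field_simps power2_eq_square)
    ultimately show ?thesis by simp
  qed
  also have "\<dots> \<le> 96 * R\<^sup>2 / norm k ^ 3 * (\<bar>sin (a * R)\<bar> + 1 / R)"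
    using R k ak a by (intro mult_right_mono divide_left_mono power_mono mult_pos_pos) auto
  finally show ?thesis by (simp add: mult_left_mono mult.assoc)
qed

section \<open>Lattice sums and simultaneous approximation\<close>

lemma one_le_norm_integer_lattice:
  fixes k :: "real ^ 'n"
  assumes "k \<in> integer_lattice" "k \<noteq> 0"
  shows "1 \<le> norm k"
proof -
  obtain i where i: "k $ i \<noteq> 0" using assms(2) by (auto simp: vec_eq_iff)
  have "k $ i \<in> \<int>" using assms(1) by (simp add: integer_lattice_def)
  then have "1 \<le> \<bar>k $ i\<bar>" using i by (rule Ints_nonzero_abs_ge1)
  also have "\<dots> \<le> norm k" by (rule component_le_norm_cart)
  finally show ?thesis .
qed

lemma sum_int_powr_bounded:
  fixes s :: real
  assumes s: "1 < s"
  shows "\<exists>C. \<forall>n::nat. (\<Sum>m\<in>{- int n..int n}. max 1 \<bar>real_of_int m\<bar> powr (- s)) \<le> C"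
proof -
  define g where "g m = max 1 \<bar>real_of_int m\<bar> powr (- s)" for m
  have "summable (\<lambda>j. real j powr (- s))" using s by (simp add: summable_real_powr_iff)
  then have sm: "summable (\<lambda>j. g (int j))"
    by (rule summable_comparison_test_ev[rotated])
      (auto simp: g_def max_def intro!: eventually_mono[OF eventually_ge_at_top[of 1]])
  have "(\<Sum>m\<in>{- int n..int n}. g m) \<le> 2 * suminf (\<lambda>j. g (int j))" for n
  proof -
    let ?A = "int ` {..n}" and ?B = "(\<lambda>j. - int j) ` {..n}"
    have "{- int n..int n} \<subseteq> ?A \<union> ?B"
    proof
      fix m assume "m \<in> {- int n..int n}"
      then show "m \<in> ?A \<union> ?B"
        by (cases "0 \<le> m") (auto simp: image_iff intro: bexI[of _ "nat m"] bexI[of _ "nat (- m)"])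
    qed
    then have "(\<Sum>m\<in>{- int n..int n}. g m) \<le> (\<Sum>m\<in>?A \<union> ?B. g m)"
      by (intro sum_mono2) (auto simp: g_def)
    also have "\<dots> \<le> (\<Sum>m\<in>?A \<union> ?B. g m) + (\<Sum>m\<in>?A \<inter> ?B. g m)"
      by (simp add: sum_nonneg g_def)
    also have "\<dots> = (\<Sum>m\<in>?A. g m) + (\<Sum>m\<in>?B. g m)" by (rule sum.union_inter) auto
    also have "\<dots> = 2 * (\<Sum>j\<le>n. g (int j))"
      by (simp add: sum.reindex inj_on_def g_def)
    also have "(\<Sum>j\<le>n. g (int j)) \<le> suminf (\<lambda>j. g (int j))"
      by (intro sum_le_suminf sm) (auto simp: g_def)
    finally show ?thesis by simp
  qed
  then show ?thesis unfolding g_def by blast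
qed

text \<open>
  For a nonzero lattice vector, each coordinate satisfies \<open>max 1 |k $ i| \<le> norm k\<close>. Spreading the exponent
  \<open>p\<close> evenly over the coordinates bounds the sum by a product of one-dimensional sums with
  exponent \<open>p / n > 1\<close>, where \<open>n\<close> is the dimension.
\<close>

lemma sum_integer_lattice_bounded:
  assumes p: "CARD('n) < p"
  shows "\<exists>Z. \<forall>S :: (real ^ 'n) set. finite S \<longrightarrow> S \<subseteq> integer_lattice - {0} \<longrightarrow> (\<Sum>k\<in>S. 1 / norm k ^ p) \<le> Z"
proof -
  define s where "s = real p / real CARD('n)"
  have s: "1 < s" using p by (simp add: s_def)
  define g where "g m = max 1 \<bar>real_of_int m\<bar> powr (- s)" for m
  obtain C where C: "\<And>n::nat. (\<Sum>m\<in>{- int n..int n}. g m) \<le> C"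
    using sum_int_powr_bounded[OF s] unfolding g_def by blast
  define F :: "real ^ 'n \<Rightarrow> 'n \<Rightarrow> int" where "F k i = \<lfloor>k $ i\<rfloor>" for k i
  have F: "k $ i = of_int (F k i)" if "k \<in> integer_lattice" for k i
    using that by (auto simp: F_def integer_lattice_def elim!: Ints_cases dest!: spec[of _ i])
  have "(\<Sum>k\<in>S. 1 / norm k ^ p) \<le> C ^ CARD('n)" if S: "finite S" "S \<subseteq> integer_lattice - {0}" for S :: "(real ^ 'n) set"
  proof -
    have le: "1 / norm k ^ p \<le> (\<Prod>i\<in>UNIV. g (F k i))" if k: "k \<in> S" for k
    proof -
      have kL: "k \<in> integer_lattice" "1 \<le> norm k" using S k one_le_norm_integer_lattice by auto
      then have k0: "0 < norm k" by linarith
      have "1 / norm k ^ p = norm k powr (- real p)"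
        using k0 by (simp add: powr_minus powr_realpow divide_inverse)
      also have "\<dots> = (norm k powr (- s)) ^ CARD('n)"
        using k0 by (simp add: powr_powr s_def flip: powr_realpow)
      also have "\<dots> = (\<Prod>i\<in>(UNIV :: 'n set). norm k powr (- s))" by simp
      also have "\<dots> \<le> (\<Prod>i\<in>UNIV. g (F k i))"
      proof (rule prod_mono, safe)
        fix i
        have "max 1 \<bar>real_of_int (F k i)\<bar> \<le> norm k"
          using kL component_le_norm_cart[of k i] by (simp flip: F)
        then show "norm k powr (- s) \<le> g (F k i)"
          unfolding g_def using s by (intro powr_mono2') auto
      qed simp
      finally show ?thesis .
    qed
    obtain b where b: "\<And>k. k \<in> S \<Longrightarrow> norm k \<le> b"
      using finite_imp_bounded[OF S(1)] bounded_iff by metis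
    define n where "n = nat \<lceil>b\<rceil>"
    have inj: "inj_on F S"
    proof (rule inj_onI)
      fix k l assume "k \<in> S" "l \<in> S" "F k = F l"
      then show "k = l" using F S(2) by (simp add: vec_eq_iff subset_iff)
    qed
    have sub: "F ` S \<subseteq> (UNIV \<rightarrow>\<^sub>E {- int n..int n})"
    proof safe
      fix k i assume k: "k \<in> S"
      have "\<bar>real_of_int (F k i)\<bar> \<le> b"
        using F[of k i] S(2) k b[OF k] component_le_norm_cart[of k i] by auto
      then have "\<bar>real_of_int (F k i)\<bar> \<le> real n" unfolding n_def by linarith
      then show "F k i \<in> {- int n..int n}" by auto
    qed auto
    have "(\<Sum>k\<in>S. 1 / norm k ^ p) \<le> (\<Sum>k\<in>S. \<Prod>i\<in>UNIV. g (F k i))"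
      by (rule sum_mono[OF le])
    also have "\<dots> = (\<Sum>f\<in>F ` S. \<Prod>i\<in>UNIV. g (f i))"
      by (simp add: sum.reindex[OF inj])
    also have "\<dots> \<le> (\<Sum>f\<in>((UNIV :: 'n set) \<rightarrow>\<^sub>E {- int n..int n}). \<Prod>i\<in>UNIV. g (f i))"
    proof (rule sum_mono2[OF _ sub])
      show "finite ((UNIV :: 'n set) \<rightarrow>\<^sub>E {- int n..int n})" by (intro finite_PiE) auto
    qed (auto simp: g_def intro!: prod_nonneg)
    also have "\<dots> = (\<Prod>i\<in>(UNIV :: 'n set). \<Sum>m\<in>{- int n..int n}. g m)"
      by (rule prod_sum_PiE[symmetric]) auto
    also have "\<dots> \<le> (\<Prod>i\<in>(UNIV :: 'n set). C)"
      by (intro prod_mono conjI C sum_nonneg) (auto simp: g_def)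
    finally show ?thesis by simp
  qed
  then show ?thesis by blast
qed

lemma nonneg_sum_tail:
  fixes f :: "'a \<Rightarrow> real"
  assumes f: "\<And>x. x \<in> A \<Longrightarrow> 0 \<le> f x" and Z: "\<And>S. finite S \<Longrightarrow> S \<subseteq> A \<Longrightarrow> sum f S \<le> Z" and e: "0 < e"
  shows "\<exists>S0. finite S0 \<and> S0 \<subseteq> A \<and> (\<forall>S. finite S \<longrightarrow> S \<subseteq> A - S0 \<longrightarrow> sum f S \<le> e)"
proof -
  let ?I = "{S. finite S \<and> S \<subseteq> A}"
  have bdd: "bdd_above (sum f ` ?I)" using Z by (auto intro!: bdd_aboveI[of _ Z])
  have "(SUP S\<in>?I. sum f S) - e < (SUP S\<in>?I. sum f S)" using e by simp
  then obtain S0 where S0: "S0 \<in> ?I" "(SUP S\<in>?I. sum f S) - e < sum f S0"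
    using less_cSUP_iff[OF _ bdd] by blast
  have "sum f S \<le> e" if S: "finite S" "S \<subseteq> A - S0" for S
  proof -
    have "sum f (S \<union> S0) \<le> (SUP S\<in>?I. sum f S)"
      using S S0 by (intro cSUP_upper bdd) auto
    moreover have "sum f (S \<union> S0) = sum f S + sum f S0"
      using S S0 by (intro sum.union_disjoint) auto
    ultimately show ?thesis using S0(2) by simp
  qed
  then show ?thesis using S0(1) by blast
qed

text \<open>
  Dirichlet's theorem gives a positive integer \<open>q\<close> such that all \<open>q * b * x\<close> are close to integers. The
  factor \<open>b\<close>, which is at least \<open>B\<close>, forces the resulting radius \<open>q * b\<close> to be large.
\<close>

lemma simultaneously_small_sines:
  fixes S :: "real set"
  assumes S: "finite S" and d: "0 < \<delta>"
  shows "\<exists>R\<ge>B. \<forall>x\<in>S. \<bar>sin (2 * pi * x * R)\<bar> \<le> \<delta>"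
proof -
  define b where "b = max B 1"
  obtain h where h: "bij_betw h {0..<card S} S"
    using ex_bij_betw_nat_finite[OF S] by blast
  obtain N :: nat where N: "2 * pi / \<delta> < real N" using reals_Archimedean2 by blast
  have "0 < 2 * pi / \<delta>" using d by simp
  then have N0: "0 < N" using N by (cases N) auto
  obtain q p where q: "0 < q" and
    qp: "\<And>i. i < card S \<Longrightarrow> \<bar>of_int q * (b * h i) - of_int (p i)\<bar> < 1 / real N"
    using Dirichlet_approx_simult[OF N0, of "card S" "\<lambda>i. b * h i"] by metis
  have "\<bar>sin (2 * pi * x * (of_int q * b))\<bar> \<le> \<delta>" if x: "x \<in> S" for x
  proof -
    have "x \<in> h ` {0..<card S}" using h x by (simp add: bij_betw_def)
    then obtain i where i: "i < card S" "x = h i" by auto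
    define t where "t = of_int q * (b * h i) - of_int (p i)"
    have "2 * pi * x * (of_int q * b) = 2 * pi * t + 2 * pi * of_int (p i)"
      by (simp add: t_def i algebra_simps)
    then have "sin (2 * pi * x * (of_int q * b)) = sin (2 * pi * t)"
      by (simp add: sin_add)
    also have "\<bar>\<dots>\<bar> \<le> \<bar>2 * pi * t\<bar>" by (rule abs_sin_x_le_abs_x)
    also have "\<dots> = 2 * pi * \<bar>t\<bar>" by (simp add: abs_mult)
    also have "\<dots> \<le> 2 * pi * (1 / real N)"
      using qp[OF i(1)] by (intro mult_left_mono) (auto simp: t_def)
    also have "\<dots> \<le> \<delta>" using N N0 d by (simp add: field_simps)
    finally show ?thesis .
  qed
  moreover have "B \<le> of_int q * b"
  proof -
    have "1 * b \<le> of_int q * b" using q by (intro mult_right_mono) (auto simp: b_def)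
    then show ?thesis by (simp add: b_def)
  qed
  ultimately show ?thesis by blast
qed

section \<open>The limes inferior\<close>

text \<open>
  A nonnegative quotient has limes inferior zero as soon as it is small at arbitrarily large
  arguments. A denominator that is a multiple of \<open>R ^ k\<close> allows smallness to be measured against
  \<open>R ^ k\<close> alone, whatever the multiple is.
\<close>

lemma liminf_ratio_eq_0:
  fixes f g :: "real \<Rightarrow> real"
  assumes f0: "\<And>R. 0 \<le> f R" and c: "0 \<le> c" and g: "\<And>R. 0 < R \<Longrightarrow> g R = R ^ k * c"
    and small: "\<And>\<epsilon> B. 0 < \<epsilon> \<Longrightarrow> \<exists>R\<ge>B. f R \<le> \<epsilon> * R ^ k"
  shows "Liminf at_top (\<lambda>R. ereal (f R / g R)) = 0"
proof (rule antisym)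
  show "0 \<le> Liminf at_top (\<lambda>R. ereal (f R / g R))"
  proof (rule Liminf_bounded, rule eventually_mono[OF eventually_gt_at_top[of 0]])
    fix R :: real assume "0 < R"
    then have "0 \<le> f R / g R" using f0[of R] c g[of R] by simp
    then show "0 \<le> ereal (f R / g R)" by simp
  qed
  show "Liminf at_top (\<lambda>R. ereal (f R / g R)) \<le> 0"
  proof (rule ccontr)
    assume "\<not> ?thesis"
    then have "0 < Liminf at_top (\<lambda>R. ereal (f R / g R))" by (simp add: not_le)
    from dense[OF this] obtain y where y: "0 < y" "y < Liminf at_top (\<lambda>R. ereal (f R / g R))"
      by blast
    from ereal_dense2[OF y(1)] obtain e where "0 < ereal e" "ereal e < y" by blast
    then have e: "0 < e" "ereal e \<le> y" by simp_all
    have "\<forall>\<^sub>F R in at_top. y < ereal (f R / g R)" using y(2) by (rule less_LiminfD)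
    then obtain B where B: "\<And>R. B \<le> R \<Longrightarrow> y < ereal (f R / g R)"
      by (auto simp: eventually_at_top_linorder)
    \<comment> \<open>For c = 0 all quotients are zero, by the convention on division by zero.\<close>
    have c': "0 < c"
    proof (rule ccontr)
      assume "\<not> 0 < c"
      then have "g (max B 1) = 0" using c g[of "max B 1"] by simp
      then have "y < 0" using B[of "max B 1"] by (simp flip: zero_ereal_def)
      then show False using y(1) by simp
    qed
    obtain R where R: "max B 1 \<le> R" "f R \<le> (e * c) * R ^ k" using small[of "e * c" "max B 1"] e c' by auto
    have "f R / g R \<le> e"
      using R g[of R] c' by (simp add: divide_le_eq mult_ac)
    then show False using B[of R] R e by (meson ereal_less_eq(3) leD max.bounded_iff order_trans)
  qed
qed

text \<open>
  The Fourier series of the variance divided by \<open>R ^ 4\<close> is dominated, uniformly in \<open>R \<ge> 1\<close>, by a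
  multiple of the convergent lattice sum of \<open>1 / |k| ^ 6\<close>. A finite set \<open>S0\<close> of frequencies thus carries all but a small
  part of it, and on \<open>S0\<close> the sines can be made small simultaneously.
\<close>

lemma number_variance_small:
  assumes e: "0 < \<epsilon>"
  shows "\<exists>R\<ge>B. number_variance (shifted_lattice_law :: (real ^ 5) measure measure) R \<le> \<epsilon> * R ^ 4"
proof -
  let ?L = "integer_lattice - {0} :: (real ^ 5) set"
  let ?f = "\<lambda>k :: real ^ 5. 1 / norm k ^ 6"
  obtain Z0 where Z0: "\<And>S. finite S \<Longrightarrow> S \<subseteq> ?L \<Longrightarrow> sum ?f S \<le> Z0"
    using sum_integer_lattice_bounded[where 'n = 5 and p = 6] by auto
  define Z where "Z = max Z0 0"
  have Z: "0 \<le> Z" "\<And>S. finite S \<Longrightarrow> S \<subseteq> ?L \<Longrightarrow> sum ?f S \<le> Z"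
    using Z0 by (auto simp: Z_def le_max_iff_disj)
  define D where "D = (unit_ball_vol 4 * 96)\<^sup>2"
  have D: "0 < D" unfolding D_def by (intro zero_less_power mult_pos_pos) simp_all
  define \<eta> where "\<eta> = \<epsilon> / (16 * D)"
  have \<eta>: "0 < \<eta>" using e D by (simp add: \<eta>_def)
  obtain S0 where S0: "finite S0" "S0 \<subseteq> ?L" "\<And>S. finite S \<Longrightarrow> S \<subseteq> ?L - S0 \<Longrightarrow> sum ?f S \<le> \<eta>"
    using nonneg_sum_tail[of ?L ?f Z \<eta>] Z(2) \<eta> by auto
  define \<delta> where "\<delta> = sqrt (\<eta> / (Z + 1))"
  have \<delta>: "0 < \<delta>" "\<delta>\<^sup>2 = \<eta> / (Z + 1)" using \<eta> Z(1) by (auto simp: \<delta>_def)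
  obtain R where R: "max B (max 1 (1 / \<delta>)) \<le> R" "\<And>k. k \<in> S0 \<Longrightarrow> \<bar>sin (2 * pi * norm k * R)\<bar> \<le> \<delta>"
    using simultaneously_small_sines[of "norm ` S0" \<delta> "max B (max 1 (1 / \<delta>))"] S0(1) \<delta>(1) by auto
  have R1: "1 \<le> R" "1 / R \<le> \<delta>" using R(1) \<delta>(1) by (auto simp: field_simps)
  obtain S :: "(real ^ 5) set" where S: "finite S" "S \<subseteq> ?L"
    "number_variance (shifted_lattice_law :: (real ^ 5) measure measure) R
      \<le> (\<Sum>k\<in>S. (norm (cball_transform R k))\<^sup>2) + \<epsilon> / 2"
    using number_variance_le_sum[of "\<epsilon> / 2" R] e by auto
  have term_le: "(norm (cball_transform R k))\<^sup>2 \<le> D * R ^ 4 * c\<^sup>2 * ?f k"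
    if k: "k \<in> ?L" and c: "\<bar>sin (2 * pi * norm k * R)\<bar> + 1 / R \<le> c" for k c
  proof -
    have k1: "1 \<le> norm k" using k one_le_norm_integer_lattice by auto
    have "norm (cball_transform R k)
        \<le> unit_ball_vol 4 * 96 * R\<^sup>2 / norm k ^ 3 * (\<bar>sin (2 * pi * norm k * R)\<bar> + 1 / R)"
      by (rule norm_cball_transform_le[OF k1 R1(1)])
    also have "\<dots> \<le> unit_ball_vol 4 * 96 * R\<^sup>2 / norm k ^ 3 * c"
      by (rule mult_left_mono[OF c]) simp
    finally have "(norm (cball_transform R k))\<^sup>2 \<le> (unit_ball_vol 4 * 96 * R\<^sup>2 / norm k ^ 3 * c)\<^sup>2"
      by (rule power_mono) simp
    also have "\<dots> = D * R ^ 4 * c\<^sup>2 * ?f k"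
      by (simp add: D_def power_mult_distrib power_divide flip: power_mult)
    finally show ?thesis .
  qed
  have "(\<Sum>k\<in>S. (norm (cball_transform R k))\<^sup>2)
      = (\<Sum>k\<in>S \<inter> S0. (norm (cball_transform R k))\<^sup>2) + (\<Sum>k\<in>S - S0. (norm (cball_transform R k))\<^sup>2)"
    using S(1) by (rule sum.Int_Diff)
  also have "\<dots> \<le> (\<Sum>k\<in>S \<inter> S0. D * R ^ 4 * (2 * \<delta>)\<^sup>2 * ?f k) + (\<Sum>k\<in>S - S0. D * R ^ 4 * 2\<^sup>2 * ?f k)"
  proof (intro add_mono sum_mono term_le)
    fix k assume "k \<in> S \<inter> S0"
    then show "\<bar>sin (2 * pi * norm k * R)\<bar> + 1 / R \<le> 2 * \<delta>" using R(2)[of k] R1(2) by auto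
  next
    fix k
    have "1 / R \<le> 1" using R1(1) by simp
    then show "\<bar>sin (2 * pi * norm k * R)\<bar> + 1 / R \<le> 2"
      using abs_sin_le_one[of "2 * pi * norm k * R"] by linarith
  qed (use S in auto)
  also have "\<dots> = D * R ^ 4 * (4 * (\<delta>\<^sup>2 * sum ?f (S \<inter> S0)) + 4 * sum ?f (S - S0))"
    by (simp only: sum_distrib_left[symmetric]) (simp add: power_mult_distrib algebra_simps)
  also have "\<dots> \<le> D * R ^ 4 * (4 * \<eta> + 4 * \<eta>)"
  proof (intro mult_left_mono add_mono)
    have "\<delta>\<^sup>2 * sum ?f (S \<inter> S0) \<le> \<delta>\<^sup>2 * Z"
      using S S0 by (intro mult_left_mono Z(2)) auto
    also have "\<dots> \<le> \<eta>" using \<eta> Z(1) by (simp add: \<delta>(2) field_simps)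
    finally show "\<delta>\<^sup>2 * sum ?f (S \<inter> S0) \<le> \<eta>" .
    show "sum ?f (S - S0) \<le> \<eta>" using S by (intro S0(3)) auto
  qed (use D R1 in auto)
  also have "\<dots> = \<epsilon> / 2 * R ^ 4" using D by (simp add: \<eta>_def field_simps)
  finally have "number_variance (shifted_lattice_law :: (real ^ 5) measure measure) R \<le> \<epsilon> / 2 * R ^ 4 + \<epsilon> / 2 * 1"
    using S(3) by simp
  also have "\<dots> \<le> \<epsilon> / 2 * R ^ 4 + \<epsilon> / 2 * R ^ 4"
    using e R1(1) by (intro add_left_mono mult_left_mono) auto
  finally show ?thesis using R(1) by (intro exI[of _ R]) (auto simp: field_simps)
qed

theorem mainTheorem2:
  shows "Liminf at_top (\<lambda>R :: real.
    ereal (number_variance (shifted_lattice_law :: (real ^ 5) measure measure) R /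
      enn2real (hausdorff_measure 4 (frontier (cball 0 R) :: (real ^ 5) set)))) = 0"
proof (rule liminf_ratio_eq_0)
  show "0 \<le> number_variance (shifted_lattice_law :: (real ^ 5) measure measure) R" for R
    unfolding number_variance_def by (rule Bochner_Integration.integral_nonneg) simp
  show "enn2real (hausdorff_measure 4 (frontier (cball 0 R) :: (real ^ 5) set))
      = R ^ 4 * enn2real (hausdorff_measure 4 (sphere 0 1 :: (real ^ 5) set))" if "0 < R" for R
    by (rule hausdorff_measure_sphere[OF that])
qed (simp_all add: number_variance_small)

end
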